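(* For any index $\mathbf{k}=(k_1,\ldots,k_r)\in(\mathbb{Z}_{\ge1})^r$, the limits $$\xi(\mathbf{k})=\lim_{n\to\infty}z_n(\mathbf{k};e^{2\pi i/n}),\qquad \xi^\star(\mathbf{k})=\lim_{n\to\infty}z_n^\star(\mathbf{k};e^{2\pi i/n})$$ exist in $\mathbb{C}$, and $$\mathrm{Re}\,\xi(\mathbf{k})\equiv\zeta_{\mathcal{S}}(\mathbf{k}),\qquad \mathrm{Re}\,\xi^\star(\mathbf{k})\equiv\zeta_{\mathcal{S}}^\star(\mathbf{k})$$ modulo $\zeta(2)\mathcal{Z}$.
   Context: For $n\ge1$, an index $\mathbf{k}=(k_1,\dots,k_r)$ of positive integers and $q\in\mathbb{C}$ with $q^m\ne1$ for $0<m<n$, set $[m]_q=\frac{1-q^m}{1-q}$ and $$z_n(\mathbf{k};q)=\sum_{n>m_1>\cdots>m_r>0}\prod_{j=1}^r\frac{q^{(k_j-1)m_j}}{[m_j]_q^{k_j}},\qquad z_n^\star(\mathbf{k};q)=\sum_{n>m_1\ge\cdots\ge m_r>0}\prod_{j=1}^r\frac{q^{(k_j-1)m_j}}{[m_j]_q^{k_j}}.$$ An index is admissible if it is empty or $k_1\ge2$. For admissible $\mathbf{k}$, $\zeta(\mathbf{k})=\sum_{m_1>\cdots>m_r>0}m_1^{-k_1}\cdots m_r^{-k_r}$ (with $\zeta(\emptyset)=1$), and $\mathcal{Z}\subset\mathbb{R}$ is the $\mathbb{Q}$-vector space (in fact $\mathbb{Q}$-algebra) spanned by all these multiple zeta values.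 Let $\mathfrak{H}^1=\mathbb{Q}\langle e_1,e_2,\ldots\rangle$ be the noncommutative polynomial algebra, with $e_{\mathbf{k}}=e_{k_1}\cdots e_{k_r}$, $e_\emptyset=1$. The stuffle product $\ast$ is the $\mathbb{Q}$-bilinear product on $\mathfrak{H}^1$ with $1\ast w=w\ast1=w$ and $e_kw\ast e_{k'}w'=e_k(w\ast e_{k'}w')+e_{k'}(e_kw\ast w')+e_{k+k'}(w\ast w')$. There is a unique $\mathbb{Q}$-algebra homomorphism $R:(\mathfrak{H}^1,\ast)\to\mathbb{R}[T]$ with $R(1)=1$, $R(e_1)=T$ and $R(e_{\mathbf{k}})=\zeta(\mathbf{k})$ for admissible $\mathbf{k}$; put $R_{\mathbf{k}}(T)=R(e_{\mathbf{k}})$. The symmetric multiple zeta value is $$\zeta_{\mathcal{S}}(k_1,\ldots,k_r)=\sum_{a=0}^r(-1)^{k_1+\cdots+k_a}R_{k_a,k_{a-1},\ldots,k_1}(T)\,R_{k_{a+1},k_{a+2},\ldots,k_r}(T),$$ which is independent of $T$ (so one may take $T=0$) and lies in $\mathcal{Z}$. The star version is $$\zeta_{\mathcal{S}}^\star(k_1,\ldots,k_r)=\sum_{\square\in\{\text{`,'},\,\text{`+'}\}}\zeta_{\mathcal{S}}(k_1\square\cdots\square k_r),$$ the sum over all $2^{r-1}$ ways of replacing each $\square$ independently by a comma or a plus sign. Congruence modulo $\zeta(2)\mathcal{Z}$ means that the difference lies in $\zeta(2)\mathcal{Z}$. *)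

theory Defs
  imports
    "HOL-Analysis.Analysis"
    "HOL-Computational_Algebra.Polynomial"
    "HOL-Library.Poly_Mapping"
    "HOL-Library.FuncSet"
begin

(* An index (k_1,...,k_r) is a list of positive naturals; the list position j corresponds to
   the mathematical index j + 1. The empty list (r = 0) is an index. *)

definition is_index :: "nat list \<Rightarrow> bool" where
  "is_index ks \<longleftrightarrow> (\<forall>k\<in>set ks. 1 \<le> k)"

definition admissible :: "nat list \<Rightarrow> bool" where
  "admissible ks \<longleftrightarrow> is_index ks \<and> (ks = [] \<or> 2 \<le> hd ks)"

definition q_int :: "complex \<Rightarrow> nat \<Rightarrow> complex" where
  "q_int q m = (1 - q ^ m) / (1 - q)"

definition z_term :: "nat list \<Rightarrow> complex \<Rightarrow> nat list \<Rightarrow> complex" where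
  "z_term ks q ms =
     (\<Prod>j<length ks. q ^ ((ks ! j - 1) * ms ! j) / q_int q (ms ! j) ^ (ks ! j))"

definition z_sum :: "nat \<Rightarrow> nat list \<Rightarrow> complex \<Rightarrow> complex" where
  "z_sum n ks q =
     (\<Sum>ms | length ms = length ks \<and> set ms \<subseteq> {0<..<n} \<and> sorted_wrt (>) ms. z_term ks q ms)"

definition z_star :: "nat \<Rightarrow> nat list \<Rightarrow> complex \<Rightarrow> complex" where
  "z_star n ks q =
     (\<Sum>ms | length ms = length ks \<and> set ms \<subseteq> {0<..<n} \<and> sorted_wrt (\<ge>) ms. z_term ks q ms)"

(* The value at n = 0 is irrelevant, as only the limit in n is used. *)
definition unit_root :: "nat \<Rightarrow> complex" where
  "unit_root n = exp (2 * of_real pi * \<i> / of_nat n)"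

definition xi :: "nat list \<Rightarrow> complex" where
  "xi ks = lim (\<lambda>n. z_sum n ks (unit_root n))"

definition xi_star :: "nat list \<Rightarrow> complex" where
  "xi_star ks = lim (\<lambda>n. z_star n ks (unit_root n))"

(* Only meaningful for admissible ks; otherwise the family is not summable. *)
definition mzv :: "nat list \<Rightarrow> real" where
  "mzv ks =
     (\<Sum>\<^sub>\<infinity>ms\<in>{ms. length ms = length ks \<and> (\<forall>m\<in>set ms. 0 < m) \<and> sorted_wrt (>) ms}.
        \<Prod>j<length ks. 1 / real (ms ! j) ^ (ks ! j))"

definition mzv_space :: "real set" where
  "mzv_space = module.span (\<lambda>(c::rat) (x::real). of_rat c * x) {mzv ks | ks. admissible ks}"

definition cong_mod_zeta2 :: "real \<Rightarrow> real \<Rightarrow> bool" where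
  "cong_mod_zeta2 x y \<longleftrightarrow> x - y \<in> {mzv [2] * w | w. w \<in> mzv_space}"

(* The vector space underlying Q<e_1, e_2, ...>: finitely supported rational combinations of
   words in positive letters. The carrier excludes words containing the non-letter 0. *)
type_synonym word_poly = "nat list \<Rightarrow>\<^sub>0 rat"

definition H1 :: "word_poly set" where
  "H1 = {f. \<forall>w\<in>Poly_Mapping.keys f. is_index w}"

definition e_word :: "nat list \<Rightarrow> word_poly" where
  "e_word ks = Poly_Mapping.single ks 1"

definition word_scale :: "rat \<Rightarrow> word_poly \<Rightarrow> word_poly" where
  "word_scale c f = Poly_Mapping.map (\<lambda>x. c * x) f"

definition lin_ext :: "(nat list \<Rightarrow> word_poly) \<Rightarrow> word_poly \<Rightarrow> word_poly" where
  "lin_ext g f = (\<Sum>w\<in>Poly_Mapping.keys f. word_scale (Poly_Mapping.lookup f w) (g w))"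

(* Left multiplication by the letter e_k in the concatenation product. *)
definition prepend :: "nat \<Rightarrow> word_poly \<Rightarrow> word_poly" where
  "prepend k = lin_ext (\<lambda>w. e_word (k # w))"

fun stuffle_words :: "nat list \<Rightarrow> nat list \<Rightarrow> word_poly" where
  "stuffle_words [] w = e_word w"
| "stuffle_words w [] = e_word w"
| "stuffle_words (k # w) (k' # w') =
     prepend k (stuffle_words w (k' # w')) +
     prepend k' (stuffle_words (k # w) w') +
     prepend (k + k') (stuffle_words w w')"

definition stuffle :: "word_poly \<Rightarrow> word_poly \<Rightarrow> word_poly" where
  "stuffle f g = lin_ext (\<lambda>u. lin_ext (\<lambda>v. stuffle_words u v) g) f"

definition stuffle_hom :: "(word_poly \<Rightarrow> real poly) \<Rightarrow> bool" where
  "stuffle_hom R \<longleftrightarrow>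
     R (e_word []) = 1 \<and>
     (\<forall>f\<in>H1. \<forall>g\<in>H1. R (f + g) = R f + R g) \<and>
     (\<forall>c. \<forall>f\<in>H1. R (word_scale c f) = smult (of_rat c) (R f)) \<and>
     (\<forall>f\<in>H1. \<forall>g\<in>H1. R (stuffle f g) = R f * R g)"

(* The unique homomorphism on H1 with the prescribed values; extensionality only fixes the
   junk values outside H1, without which THE would be ill-defined. *)
definition stuffle_reg :: "word_poly \<Rightarrow> real poly" where
  "stuffle_reg = (THE R. R \<in> extensional H1 \<and> stuffle_hom R \<and> R (e_word [1]) = [:0, 1:] \<and>
                 (\<forall>ks. admissible ks \<longrightarrow> R (e_word ks) = [:mzv ks:]))"

definition zeta_S_poly :: "nat list \<Rightarrow> real poly" where
  "zeta_S_poly ks =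
     (\<Sum>a\<le>length ks. (-1) ^ sum_list (take a ks) * 
        stuffle_reg (e_word (rev (take a ks))) * stuffle_reg (e_word (drop a ks)))"

(* The polynomial is constant in T, so it is evaluated at T = 0. *)
definition zeta_S :: "nat list \<Rightarrow> real" where
  "zeta_S ks = poly (zeta_S_poly ks) 0"

datatype separator = Comma | Plus

fun fill :: "separator list \<Rightarrow> nat list \<Rightarrow> nat list" where
  "fill (Comma # s) (k # l # ks) = k # fill s (l # ks)"
| "fill (Plus # s) (k # l # ks) = fill s ((k + l) # ks)"
| "fill s ks = ks"

(* For the empty index the only choice is the empty one, so zeta_S_star [] = zeta_S []. *)
definition zeta_S_star :: "nat list \<Rightarrow> real" where
  "zeta_S_star ks = (\<Sum>s | length s = length ks - 1. zeta_S (fill s ks))"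

end

theory Submission
  imports Defs
begin

text \<open>
  The limit is governed by the regularized multiple harmonic sums at both ends of the range of
  summation. At \<open>q = exp (2\<pi>\<i>/n)\<close> put \<open>u = 1/[m]\<close> and \<open>v = q\<^sup>m/[m]\<close>; the factor belonging to an
  entry \<open>k\<close> is \<open>u v\<^bsup>k-1\<^esup>\<close>. For \<open>m \<le> n/2\<close> both \<open>u\<close> and \<open>v\<close> are within \<open>O(1/n)\<close> of \<open>1/m\<close>, and the
  reflection \<open>m \<mapsto> n - m\<close> turns \<open>u, v\<close> into \<open>-v, -u\<close>. Cutting the sum \<open>z\<^sub>n(k\<^sub>1,\<dots>,k\<^sub>r)\<close> in the middle
  therefore gives (\<open>z_sum_split\<close>)
  \<open>\<Sum>\<^sub>a (-1)\<^bsup>k\<^sub>1+\<dots>+k\<^sub>a\<^esup> B\<^sub>n(k\<^sub>a,\<dots>,k\<^sub>1) A\<^sub>n(k\<^bsub>a+1\<^esub>,\<dots>,k\<^sub>r)\<close>,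
  where \<open>A\<^sub>n\<close> and \<open>B\<^sub>n\<close> are truncated multiple sums over letters that are close to \<open>1/m\<^sup>k\<close>.

  Each of \<open>A\<^sub>n\<close>, \<open>B\<^sub>n\<close> is almost multiplicative for the stuffle product and converges to \<open>\<zeta>(k)\<close> on
  admissible indices, with errors smaller than every power of \<open>1/log n\<close>. The algebra of indices is
  generated over the admissible ones by \<open>e\<^sub>1\<close> (\<open>H1_induct\<close>), so these two facts force
  \<open>A\<^sub>n(k) = R\<^sub>k(A\<^sub>n(1)) + o(1)\<close> and likewise for \<open>B\<^sub>n\<close> (\<open>stuffle_reg_asymptotics\<close>). The same argument
  for the ordinary harmonic sums, where the stuffle product holds exactly, produces the homomorphism
  \<open>R\<close> in the first place: \<open>R\<^sub>k\<close> is the polynomial that describes the growth of the truncated sum in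
  terms of the harmonic number (\<open>stuffle_reg_eq\<close>).

  The logarithms cancel. Since \<open>u - v = 1 - q\<close>, one finds \<open>B\<^sub>n(1) = A\<^sub>n(1) + \<pi>\<i> + O(1/n)\<close>
  (\<open>harmonic_shift\<close>), and so \<open>z\<^sub>n\<close> is asymptotically the value at \<open>T = A\<^sub>n(1)\<close> of
  \<open>\<Sum>\<^sub>a (-1)\<^bsup>k\<^sub>1+\<dots>+k\<^sub>a\<^esup> R\<^bsub>k\<^sub>a,\<dots>,k\<^sub>1\<^esub>(T + \<pi>\<i>) R\<^bsub>k\<^bsub>a+1\<^esub>,\<dots>,k\<^sub>r\<^esub>(T)\<close>.
  Removing a leading 1 from an index is a derivation for the stuffle product and corresponds to
  \<open>d/dT\<close> (\<open>pderiv_stuffle_reg\<close>), so the derivative of this polynomial telescopes to 0. Its constant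
  value is the limit; evaluating at \<open>T = -\<pi>\<i>/2\<close> gives \<open>\<xi>\<close> as a combination of products
  \<open>R(\<pi>\<i>/2) R(-\<pi>\<i>/2)\<close> (\<open>z_sum_tendsto\<close>). The coefficients of \<open>R\<close> lie in the ring of multiple zeta
  values and \<open>(\<pi>\<i>/2)\<^sup>2 = -3/2 \<zeta>(2)\<close>, so in the real part only the products of constant terms survive
  modulo \<open>\<zeta>(2)\<close>, and these add up to the symmetric multiple zeta value (\<open>xi_cong\<close>).

  The star sum is, up to errors with a factor \<open>1 - q\<close>, the sum of the \<open>z\<^sub>n\<close> over all ways of merging
  adjacent entries, because \<open>u v\<^bsup>k-1\<^esup> \<cdot> u v\<^bsup>l-1\<^esup>\<close> differs from \<open>u v\<^bsup>k+l-1\<^esup>\<close> by a multiple of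
  \<open>u - v = 1 - q\<close> (\<open>star_msum_approx\<close>).
\<close>

section \<open>Linear algebra of word polynomials\<close>

lemma lookup_word_scale [simp]:
  "Poly_Mapping.lookup (word_scale c f) w = c * Poly_Mapping.lookup f w"
  by (simp add: word_scale_def Poly_Mapping.map.rep_eq when_def)

lemma word_scale_add: "word_scale c (f + g) = word_scale c f + word_scale c g"
  by (rule poly_mapping_eqI) (simp add: lookup_add algebra_simps)

lemma word_scale_add_left: "word_scale (c + d) f = word_scale c f + word_scale d f"
  by (rule poly_mapping_eqI) (simp add: lookup_add algebra_simps)

lemma word_scale_word_scale: "word_scale c (word_scale d f) = word_scale (c * d) f"
  by (rule poly_mapping_eqI) simp

lemma word_scale_0 [simp]: "word_scale 0 f = 0" "word_scale c 0 = 0"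
  by (rule poly_mapping_eqI, simp)+

lemma word_scale_1 [simp]: "word_scale 1 f = f"
  by (rule poly_mapping_eqI) simp

lemma keys_word_scale: "Poly_Mapping.keys (word_scale c f) \<subseteq> Poly_Mapping.keys f"
  by (auto simp: in_keys_iff)

lemma keys_e_word [simp]: "Poly_Mapping.keys (e_word w) = {w}"
  by (simp add: e_word_def)

lemma word_poly_expand:
  assumes "finite A" "Poly_Mapping.keys f \<subseteq> A"
  shows "f = (\<Sum>w\<in>A. word_scale (Poly_Mapping.lookup f w) (e_word w))"
proof (rule poly_mapping_eqI)
  fix v
  have "(\<Sum>w\<in>A. Poly_Mapping.lookup f w * Poly_Mapping.lookup (e_word w) v) =
        (\<Sum>w\<in>A. if w = v then Poly_Mapping.lookup f w else 0)"
    by (intro sum.cong) (auto simp: e_word_def lookup_single)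
  also have "\<dots> = Poly_Mapping.lookup f v"
    using assms by (auto simp: in_keys_iff sum.delta)
  finally show "Poly_Mapping.lookup f v =
      Poly_Mapping.lookup (\<Sum>w\<in>A. word_scale (Poly_Mapping.lookup f w) (e_word w)) v"
    by (simp add: lookup_sum)
qed

lemma word_poly_induct [consumes 1, case_names zero word add scale]:
  assumes "Poly_Mapping.keys f \<subseteq> W"
    and zero: "P 0"
    and word: "\<And>w. w \<in> W \<Longrightarrow> P (e_word w)"
    and add: "\<And>f g. P f \<Longrightarrow> P g \<Longrightarrow> P (f + g)"
    and scale: "\<And>c f. P f \<Longrightarrow> P (word_scale c f)"
  shows "P f"
proof -
  have "P (\<Sum>w\<in>A. word_scale (c w) (e_word w))" if "finite A" "A \<subseteq> W" for A and c :: "nat list \<Rightarrow> rat"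
    using that by (induction rule: finite_induct) (auto intro: zero word add scale)
  from this[of "Poly_Mapping.keys f" "Poly_Mapping.lookup f"] show ?thesis
    using assms(1) word_poly_expand[of "Poly_Mapping.keys f" f] by simp
qed

text \<open>The counterpart of \<^const>\<open>lin_ext\<close> for functions with values in a field.\<close>

definition lin_eval :: "(nat list \<Rightarrow> 'a::field_char_0) \<Rightarrow> word_poly \<Rightarrow> 'a" where
  "lin_eval \<phi> f = (\<Sum>w\<in>Poly_Mapping.keys f. of_rat (Poly_Mapping.lookup f w) * \<phi> w)"

lemma lin_eval_superset:
  "finite A \<Longrightarrow> Poly_Mapping.keys f \<subseteq> A \<Longrightarrow>
    lin_eval \<phi> f = (\<Sum>w\<in>A. of_rat (Poly_Mapping.lookup f w) * \<phi> w)"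
  unfolding lin_eval_def by (rule sum.mono_neutral_left) (auto simp: in_keys_iff)

lemma lin_eval_add: "lin_eval \<phi> (f + g) = lin_eval \<phi> f + lin_eval \<phi> g"
proof -
  let ?A = "Poly_Mapping.keys f \<union> Poly_Mapping.keys g"
  have "Poly_Mapping.keys (f + g) \<subseteq> ?A" by (rule keys_add)
  then show ?thesis
    by (simp add: lin_eval_superset[of ?A] lookup_add of_rat_add sum.distrib algebra_simps)
qed

lemma lin_eval_scale: "lin_eval \<phi> (word_scale c f) = of_rat c * lin_eval \<phi> f"
  by (simp add: lin_eval_superset[of "Poly_Mapping.keys f" _ \<phi>] keys_word_scale of_rat_mult
      sum_distrib_left mult.assoc)

lemma lin_eval_e_word [simp]: "lin_eval \<phi> (e_word w) = \<phi> w"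
  by (simp add: lin_eval_def e_word_def)

lemma lin_eval_0 [simp]: "lin_eval \<phi> 0 = 0"
  by (simp add: lin_eval_def)

lemma lin_eval_cong: "(\<And>w. w \<in> Poly_Mapping.keys f \<Longrightarrow> \<phi> w = \<psi> w) \<Longrightarrow> lin_eval \<phi> f = lin_eval \<psi> f"
  unfolding lin_eval_def by (rule sum.cong) auto

lemma lin_ext_superset:
  "finite A \<Longrightarrow> Poly_Mapping.keys f \<subseteq> A \<Longrightarrow>
    lin_ext g f = (\<Sum>w\<in>A. word_scale (Poly_Mapping.lookup f w) (g w))"
  unfolding lin_ext_def by (rule sum.mono_neutral_left) (auto simp: in_keys_iff)

lemma lin_ext_add: "lin_ext h (f + g) = lin_ext h f + lin_ext h g"
proof -
  let ?A = "Poly_Mapping.keys f \<union> Poly_Mapping.keys g"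
  have "Poly_Mapping.keys (f + g) \<subseteq> ?A" by (rule keys_add)
  then show ?thesis
    by (simp add: lin_ext_superset[of ?A] lookup_add word_scale_add_left sum.distrib)
qed

lemma word_scale_sum: "word_scale c (sum g A) = (\<Sum>w\<in>A. word_scale c (g w))"
  by (induction A rule: infinite_finite_induct) (auto simp: word_scale_add)

lemma lin_ext_scale: "lin_ext h (word_scale c f) = word_scale c (lin_ext h f)"
  by (simp add: lin_ext_superset[of "Poly_Mapping.keys f" _ h] keys_word_scale word_scale_sum
      word_scale_word_scale)

lemma lin_ext_e_word [simp]: "lin_ext h (e_word w) = h w"
  by (simp add: lin_ext_def e_word_def)

lemma lin_ext_0 [simp]: "lin_ext h 0 = 0"
  by (simp add: lin_ext_def)

lemma lin_eval_lin_ext: "lin_eval \<phi> (lin_ext h f) = lin_eval (\<lambda>w. lin_eval \<phi> (h w)) f"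
proof -
  have "Poly_Mapping.keys f \<subseteq> UNIV" by simp
  then show ?thesis
    by (induction rule: word_poly_induct)
      (auto simp: lin_ext_add lin_eval_add lin_ext_scale lin_eval_scale)
qed

lemma keys_lin_ext:
  assumes "\<And>w. w \<in> Poly_Mapping.keys f \<Longrightarrow> Poly_Mapping.keys (h w) \<subseteq> W"
  shows "Poly_Mapping.keys (lin_ext h f) \<subseteq> W"
  unfolding lin_ext_def
  by (rule subset_trans[OF keys_sum]) (use assms keys_word_scale in blast)

lemma prepend_e_word [simp]: "prepend k (e_word w) = e_word (k # w)"
  by (simp add: prepend_def)

lemma prepend_add: "prepend k (f + g) = prepend k f + prepend k g"
  by (simp add: prepend_def lin_ext_add)

lemma prepend_scale: "prepend k (word_scale c f) = word_scale c (prepend k f)"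
  by (simp add: prepend_def lin_ext_scale)

lemma keys_prepend: "Poly_Mapping.keys (prepend k f) \<subseteq> (#) k ` Poly_Mapping.keys f"
  unfolding prepend_def by (rule keys_lin_ext) auto

lemma keys_prepend_subset:
  assumes "Poly_Mapping.keys f \<subseteq> W" "(#) k ` W \<subseteq> V"
  shows "Poly_Mapping.keys (prepend k f) \<subseteq> V"
  using keys_prepend[of k f] assms by blast

lemma keys_add_subset:
  "Poly_Mapping.keys f \<subseteq> W \<Longrightarrow> Poly_Mapping.keys g \<subseteq> W \<Longrightarrow> Poly_Mapping.keys (f + g) \<subseteq> W"
  using keys_add[of f g] by blast

section \<open>Generation of the stuffle algebra by the letter 1\<close>

lemma stuffle_words_Nil2 [simp]: "stuffle_words w [] = e_word w"
  by (cases w) auto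

lemma H1_iff: "f \<in> H1 \<longleftrightarrow> Poly_Mapping.keys f \<subseteq> Collect is_index"
  by (auto simp: H1_def)

lemma e_word_in_H1_iff [simp]: "e_word w \<in> H1 \<longleftrightarrow> is_index w"
  by (simp add: H1_iff)

lemma H1_add: "f \<in> H1 \<Longrightarrow> g \<in> H1 \<Longrightarrow> f + g \<in> H1"
  unfolding H1_iff by (rule keys_add_subset)

lemma H1_scale: "f \<in> H1 \<Longrightarrow> word_scale c f \<in> H1"
  unfolding H1_iff using keys_word_scale by blast

lemma H1_0 [simp]: "0 \<in> H1"
  by (simp add: H1_iff)

lemma is_index_Nil [simp]: "is_index []"
  by (simp add: is_index_def)

lemma is_index_Cons [simp]: "is_index (k # w) \<longleftrightarrow> 1 \<le> k \<and> is_index w"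
  by (simp add: is_index_def)

lemma keys_stuffle_words_index:
  "is_index u \<Longrightarrow> is_index v \<Longrightarrow> Poly_Mapping.keys (stuffle_words u v) \<subseteq> Collect is_index"
proof (induction u v rule: stuffle_words.induct)
  case (3 k w k' w')
  then show ?case
    unfolding stuffle_words.simps
    by (intro keys_add_subset keys_prepend_subset[where W="Collect is_index"]) auto
qed auto

lemma stuffle_in_H1: "f \<in> H1 \<Longrightarrow> g \<in> H1 \<Longrightarrow> stuffle f g \<in> H1"
  unfolding stuffle_def H1_iff
  by (intro keys_lin_ext keys_stuffle_words_index) auto

lemma stuffle_e_word: "stuffle (e_word u) g = lin_ext (stuffle_words u) g"
  by (simp add: stuffle_def)

lemma stuffle_e_words [simp]: "stuffle (e_word u) (e_word v) = stuffle_words u v"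
  by (simp add: stuffle_e_word)

text \<open>The first letter of every word in the product is a first letter of a factor or the sum of both.
  This is what makes the span of the multiple zeta values a ring.\<close>
lemma keys_stuffle_words_admissible:
  assumes "admissible u" "admissible v"
  shows "Poly_Mapping.keys (stuffle_words u v) \<subseteq> Collect admissible"
proof (cases u)
  case (Cons k u')
  show ?thesis
  proof (cases v)
    case v: (Cons l v')
    have *: "Poly_Mapping.keys (prepend j f) \<subseteq> Collect admissible"
      if "2 \<le> j" "Poly_Mapping.keys f \<subseteq> Collect is_index" for j f
      by (rule keys_prepend_subset[OF that(2)]) (use that(1) in \<open>auto simp: admissible_def\<close>)
    show ?thesis
      using assms unfolding Cons v stuffle_words.simps
      by (intro keys_add_subset * keys_stuffle_words_index) (auto simp: admissible_def)
  qed (use assms in auto)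
qed (use assms in auto)

definition lead_ones :: "nat list \<Rightarrow> nat" where
  "lead_ones w = length (takeWhile (\<lambda>k. k = 1) w)"

lemma lead_ones_simps [simp]:
  "lead_ones [] = 0" "lead_ones (Suc 0 # w) = Suc (lead_ones w)" "k \<noteq> 1 \<Longrightarrow> lead_ones (k # w) = 0"
  by (auto simp: lead_ones_def)

lemma admissible_iff_lead_ones: "admissible w \<longleftrightarrow> is_index w \<and> lead_ones w = 0"
  by (cases w) (auto simp: admissible_def lead_ones_def)

lemma stuffle_words_1_Cons:
  "stuffle_words [1] (k # w) = e_word (1 # k # w) + prepend k (stuffle_words [1] w)
     + e_word ((k + 1) # w)"
  by (simp add: add_ac)

text \<open>Inserting the letter 1 next to any of the leading ones gives the same word, hence the
  coefficient; inserting it later or merging it leaves at most as many leading ones as before.\<close>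
lemma stuffle_words_1_leading:
  assumes "is_index w"
  shows "\<exists>g. stuffle_words [1] w = word_scale (of_nat (Suc (lead_ones w))) (e_word (1 # w)) + g \<and>
             Poly_Mapping.keys g \<subseteq> {v. is_index v \<and> lead_ones v \<le> lead_ones w}"
  using assms
proof (induction w)
  case Nil
  show ?case by (intro exI[of _ 0]) simp
next
  case (Cons k w)
  show ?case
  proof (cases "k = 1")
    case False
    then have k: "2 \<le> k" using Cons.prems by simp
    let ?g = "prepend k (stuffle_words [1] w) + e_word ((k + 1) # w)"
    have "Poly_Mapping.keys ?g \<subseteq> {v. is_index v \<and> lead_ones v \<le> lead_ones (k # w)}"
      using k Cons.prems
      by (intro keys_add_subset keys_prepend_subset[OF keys_stuffle_words_index]) auto
    then show ?thesis
      using False by (intro exI[of _ ?g]) (simp add: stuffle_words_1_Cons[of k w, simplified] add_ac)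
  next
    case True
    from Cons obtain g where g: "stuffle_words [1] w =
        word_scale (of_nat (Suc (lead_ones w))) (e_word (1 # w)) + g"
      "Poly_Mapping.keys g \<subseteq> {v. is_index v \<and> lead_ones v \<le> lead_ones w}" by auto
    let ?g = "prepend 1 g + e_word (2 # w)"
    have "stuffle_words [1] (1 # w) = e_word (1 # 1 # w)
        + word_scale (of_nat (Suc (lead_ones w))) (e_word (1 # 1 # w)) + ?g"
      using stuffle_words_1_Cons[of 1 w] unfolding g(1) prepend_add prepend_scale prepend_e_word
      by (simp add: add_ac numeral_2_eq_2)
    also have "e_word (1 # 1 # w) + word_scale (of_nat (Suc (lead_ones w))) (e_word (1 # 1 # w))
       = word_scale (of_nat (Suc (lead_ones (1 # w)))) (e_word (1 # 1 # w))"
      by (rule poly_mapping_eqI) (simp add: lookup_add algebra_simps)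
    finally have "stuffle_words [1] (1 # w) =
      word_scale (of_nat (Suc (lead_ones (1 # w)))) (e_word (1 # 1 # w)) + ?g" .
    moreover have "Poly_Mapping.keys ?g \<subseteq> {v. is_index v \<and> lead_ones v \<le> lead_ones (1 # w)}"
      using Cons.prems by (intro keys_add_subset keys_prepend_subset[OF g(2)]) auto
    ultimately show ?thesis using True by blast
  qed
qed

text \<open>A property that holds for the admissible words, is linear, and is stable under
  multiplication by \<open>e\<^sub>1\<close>, holds everywhere: \<open>stuffle_words_1_leading\<close> can be solved for
  \<open>e_word (1 # v)\<close> modulo words with fewer leading ones. Existence, uniqueness, derivative and
  asymptotic meaning of the regularization all rest on this rule.\<close>
lemma H1_induct [consumes 1, case_names admissible add scale stuffle]:
  assumes "f \<in> H1"
    and adm: "\<And>w. admissible w \<Longrightarrow> P (e_word w)"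
    and add: "\<And>f g. f \<in> H1 \<Longrightarrow> g \<in> H1 \<Longrightarrow> P f \<Longrightarrow> P g \<Longrightarrow> P (f + g)"
    and scale: "\<And>c f. f \<in> H1 \<Longrightarrow> P f \<Longrightarrow> P (word_scale c f)"
    and stuffle: "\<And>f. f \<in> H1 \<Longrightarrow> P f \<Longrightarrow> P (stuffle (e_word [1]) f)"
  shows "P f"
proof -
  define Q where "Q f \<longleftrightarrow> f \<in> H1 \<and> P f" for f
  have Q0: "Q 0"
    using scale[of "e_word []" 0] adm[of "[]"] by (simp add: Q_def admissible_def)
  have Qadd: "Q (f + g)" if "Q f" "Q g" for f g using that by (auto simp: Q_def add H1_add)
  have Qscale: "Q (word_scale c f)" if "Q f" for c f using that by (auto simp: Q_def scale H1_scale)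
  have words: "Q (e_word w)" if "is_index w" for w
    using that
  proof (induction "lead_ones w" arbitrary: w rule: less_induct)
    case less
    show ?case
    proof (cases "lead_ones w = 0")
      case True
      then show ?thesis using less.prems adm by (simp add: Q_def admissible_iff_lead_ones)
    next
      case False
      then obtain v where w: "w = 1 # v"
        by (cases w) (auto simp: lead_ones_def split: if_splits)
      have v: "is_index v" using less.prems w by simp
      obtain g where g: "stuffle_words [1] v =
          word_scale (of_nat (Suc (lead_ones v))) (e_word (1 # v)) + g"
        "Poly_Mapping.keys g \<subseteq> {v'. is_index v' \<and> lead_ones v' \<le> lead_ones v}"
        using stuffle_words_1_leading[OF v] by blast
      have "Q g" using g(2)
        by (induction rule: word_poly_induct) (auto intro!: Q0 Qadd Qscale less.hyps simp: w)
      moreover have "Q (e_word v)" by (rule less.hyps) (auto simp: w v)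
      then have "Q (stuffle (e_word [1]) (e_word v))"
        unfolding Q_def using stuffle[of "e_word v"] stuffle_in_H1[of "e_word [1]" "e_word v"]
        by simp
      ultimately have "Q (word_scale (1 / of_nat (Suc (lead_ones v)))
          (stuffle (e_word [1]) (e_word v) + word_scale (-1) g))"
        by (intro Qadd Qscale)
      also have "stuffle (e_word [1]) (e_word v) + word_scale (-1) g =
          word_scale (of_nat (Suc (lead_ones v))) (e_word w)"
        unfolding stuffle_e_words g(1) w
        by (rule poly_mapping_eqI) (simp add: lookup_add)
      also have "word_scale (1 / of_nat (Suc (lead_ones v))) \<dots> = e_word w"
        by (simp add: word_scale_word_scale del: of_nat_Suc)
      finally show ?thesis .
    qed
  qed
  have "Poly_Mapping.keys f \<subseteq> Collect is_index" using assms(1) by (simp add: H1_iff)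
  then have "Q f" by (induction rule: word_poly_induct) (auto intro: Q0 Qadd Qscale words)
  then show ?thesis by (simp add: Q_def)
qed

text \<open>By \<open>H1_induct\<close> the index algebra behaves like a polynomial ring in \<open>e\<^sub>1\<close> over the admissible
  words; this map is the derivative with respect to \<open>e\<^sub>1\<close>.\<close>
definition drop_one :: "word_poly \<Rightarrow> word_poly" where
  "drop_one = lin_ext (\<lambda>w. if w \<noteq> [] \<and> hd w = 1 then e_word (tl w) else 0)"

lemma drop_one_add: "drop_one (f + g) = drop_one f + drop_one g"
  by (simp add: drop_one_def lin_ext_add)

lemma drop_one_scale: "drop_one (word_scale c f) = word_scale c (drop_one f)"
  by (simp add: drop_one_def lin_ext_scale)

lemma drop_one_e_word: "drop_one (e_word w) = (if w \<noteq> [] \<and> hd w = 1 then e_word (tl w) else 0)"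
  by (simp add: drop_one_def)

lemma drop_one_prepend: "drop_one (prepend k f) = (if k = 1 then f else 0)"
proof -
  have "Poly_Mapping.keys f \<subseteq> UNIV" by simp
  then show ?thesis
    by (induction rule: word_poly_induct)
       (auto simp: drop_one_add drop_one_scale drop_one_e_word prepend_add prepend_scale,
        auto simp: prepend_def drop_one_def)
qed

lemma drop_one_in_H1: "f \<in> H1 \<Longrightarrow> drop_one f \<in> H1"
  unfolding drop_one_def H1_iff 
  by (intro keys_lin_ext) (auto simp: is_index_def dest: list.set_sel(2), metis list.set_sel(2) mem_Collect_eq subsetD is_index_def One_nat_def)

lemma stuffle_add_right: "stuffle (e_word u) (f + g) = stuffle (e_word u) f + stuffle (e_word u) g"
  by (simp add: stuffle_e_word lin_ext_add)

lemma stuffle_scale_right: "stuffle (e_word u) (word_scale c f) = word_scale c (stuffle (e_word u) f)"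
  by (simp add: stuffle_e_word lin_ext_scale)

text \<open>This case of the Leibniz rule holds because merging two positive letters yields a letter
  that is at least 2, so only unmerged letters can contribute a leading 1.\<close>
lemma drop_one_stuffle_1:
  assumes "f \<in> H1"
  shows "drop_one (stuffle (e_word [1]) f) = f + stuffle (e_word [1]) (drop_one f)"
proof -
  have "Poly_Mapping.keys f \<subseteq> Collect is_index" using assms by (simp add: H1_iff)
  then show ?thesis
  proof (induction rule: word_poly_induct)
    case zero
    then show ?case by (simp add: stuffle_e_word drop_one_def)
  next
    case (word w)
    show ?case
    proof (cases w)
      case Nil
      then show ?thesis by (simp add: drop_one_e_word stuffle_e_word)
    next
      case (Cons k v)
      with word have "1 \<le> k" by simp
      then show ?thesis unfolding Cons stuffle_e_words stuffle_words_1_Cons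
        by (auto simp: drop_one_add drop_one_e_word drop_one_prepend stuffle_e_word)
    qed
  next
    case (add f g)
    then show ?case by (simp add: stuffle_add_right drop_one_add)
  next
    case (scale c f)
    then show ?case by (simp add: stuffle_scale_right drop_one_scale word_scale_add)
  qed
qed

lemma lin_eval_stuffle:
  "lin_eval \<phi> (stuffle f g) = lin_eval (\<lambda>u. lin_eval (\<lambda>v. lin_eval \<phi> (stuffle_words u v)) g) f"
  by (simp add: stuffle_def lin_eval_lin_ext)

section \<open>Truncated multiple sums\<close>

text \<open>The sum over \<open>N \<ge> m\<^sub>1 > \<dots> > m\<^sub>r > M\<close>, defined by recursion on the largest variable; the
  identification with sums over decreasing lists is \<open>msum_eq_sum_lists\<close>. The lower bound \<open>M\<close> is a
  parameter so that a sum can be cut into two ranges.\<close>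
fun msum :: "(nat \<Rightarrow> nat \<Rightarrow> 'a::comm_ring_1) \<Rightarrow> nat \<Rightarrow> nat \<Rightarrow> nat list \<Rightarrow> 'a" where
  "msum t M N [] = 1"
| "msum t M N (k # ks) = (\<Sum>m\<in>{M<..N}. t k m * msum t M (m - 1) ks)"

fun star_msum :: "(nat \<Rightarrow> nat \<Rightarrow> 'a::comm_ring_1) \<Rightarrow> nat \<Rightarrow> nat list \<Rightarrow> 'a" where
  "star_msum t N [] = 1"
| "star_msum t N (k # ks) = (\<Sum>m\<in>{0<..N}. t k m * star_msum t m ks)"

lemma finite_bounded_lists: "finite {ms. length ms = l \<and> set ms \<subseteq> {M<..N::nat} \<and> P ms}"
  by (rule finite_subset[OF _ finite_lists_length_eq[of "{M<..N}" l]]) auto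

text \<open>Strict and weak chains are treated together: \<open>h m\<close> is the largest value allowed after
  \<open>m\<close>, that is \<open>m - 1\<close> or \<open>m\<close>.\<close>
lemma sum_sorted_lists:
  fixes t :: "nat \<Rightarrow> nat \<Rightarrow> 'a::comm_ring_1"
  assumes R: "\<And>m m' N. M < m \<Longrightarrow> m \<le> N \<Longrightarrow> M < m' \<Longrightarrow> m' \<le> N \<and> R m m' \<longleftrightarrow> m' \<le> h m"
    and F_Nil: "\<And>N. F N [] = 1"
    and F_Cons: "\<And>N k ks. F N (k # ks) = (\<Sum>m\<in>{M<..N}. t k m * F (h m) ks)"
  shows "(\<Sum>ms | length ms = length ks \<and> set ms \<subseteq> {M<..N} \<and> sorted_wrt R ms.
            \<Prod>j<length ks. t (ks ! j) (ms ! j)) = F N ks"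
proof (induction ks arbitrary: N)
  case Nil
  have "{ms. length ms = length [] \<and> set ms \<subseteq> {M<..N} \<and> sorted_wrt R ms} = {[]}" by auto
  then show ?case by (simp add: F_Nil)
next
  case (Cons k ks)
  let ?D = "\<lambda>ks N. {ms. length ms = length ks \<and> set ms \<subseteq> {M<..N} \<and> sorted_wrt R ms}"
  have D: "?D (k # ks) N = (\<lambda>(m, ms). m # ms) ` Sigma {M<..N} (\<lambda>m. ?D ks (h m))"
  proof (intro equalityI subsetI)
    fix ms assume "ms \<in> ?D (k # ks) N"
    then obtain m ms' where ms: "ms = m # ms'" and
      *: "length ms' = length ks" "M < m" "m \<le> N" "set ms' \<subseteq> {M<..N}"
      "\<forall>m'\<in>set ms'. R m m'" "sorted_wrt R ms'" by (cases ms) auto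
    have "set ms' \<subseteq> {M<..h m}" using * R[OF \<open>M < m\<close> \<open>m \<le> N\<close>] by fastforce
    then show "ms \<in> (\<lambda>(m, ms). m # ms) ` Sigma {M<..N} (\<lambda>m. ?D ks (h m))"
      using * ms by auto
  next
    fix ms assume "ms \<in> (\<lambda>(m, ms). m # ms) ` Sigma {M<..N} (\<lambda>m. ?D ks (h m))"
    then obtain m ms' where ms: "ms = m # ms'" and
      *: "length ms' = length ks" "M < m" "m \<le> N" "set ms' \<subseteq> {M<..h m}" "sorted_wrt R ms'" by auto
    have "M < m' \<and> m' \<le> N \<and> R m m'" if "m' \<in> set ms'" for m'
      using * R[OF \<open>M < m\<close> \<open>m \<le> N\<close>, of m'] that by auto
    then show "ms \<in> ?D (k # ks) N" using * ms by auto
  qed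
  have inj: "inj_on (\<lambda>(m, ms). m # ms) (Sigma {M<..N} (\<lambda>m. ?D ks (h m)))"
    by (auto simp: inj_on_def)
  have "(\<Sum>ms\<in>?D (k # ks) N. \<Prod>j<length (k # ks). t ((k # ks) ! j) (ms ! j)) =
        (\<Sum>(m, ms)\<in>Sigma {M<..N} (\<lambda>m. ?D ks (h m)). t k m * (\<Prod>j<length ks. t (ks ! j) (ms ! j)))"
    unfolding D sum.reindex[OF inj]
    by (intro sum.cong refl) (auto simp: prod.lessThan_Suc_shift simp del: prod.lessThan_Suc)
  also have "\<dots> = (\<Sum>m\<in>{M<..N}. \<Sum>ms\<in>?D ks (h m). t k m * (\<Prod>j<length ks. t (ks ! j) (ms ! j)))"
    by (rule sum.Sigma[symmetric]) (auto intro: finite_bounded_lists)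
  also have "\<dots> = F N (k # ks)"
    by (simp add: F_Cons Cons.IH sum_distrib_left[symmetric])
  finally show ?case .
qed

lemma msum_eq_sum_lists:
  "msum t M N ks = (\<Sum>ms | length ms = length ks \<and> set ms \<subseteq> {M<..N} \<and> sorted_wrt (>) ms.
            \<Prod>j<length ks. t (ks ! j) (ms ! j))"
  by (rule sum_sorted_lists[where h="\<lambda>m. m - 1" and F="msum t M", symmetric]) auto

lemma star_msum_eq_sum_lists:
  "star_msum t N ks = (\<Sum>ms | length ms = length ks \<and> set ms \<subseteq> {0<..N} \<and> sorted_wrt (\<ge>) ms.
            \<Prod>j<length ks. t (ks ! j) (ms ! j))"
  by (rule sum_sorted_lists[where h="\<lambda>m. m" and F="star_msum t", symmetric]) auto

lemma msum_cong:
  "(\<And>k m. k \<in> set ks \<Longrightarrow> M < m \<Longrightarrow> m \<le> N \<Longrightarrow> t k m = t' k m) \<Longrightarrow> msum t M N ks = msum t' M N ks"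
  by (induction ks arbitrary: N) (auto intro!: sum.cong arg_cong2[where f="(*)"])

text \<open>The variables above the cut \<open>M\<close> form an initial segment of the decreasing chain; the
  summation index \<open>a\<close> is its length.\<close>
lemma msum_split:
  assumes "M \<le> N"
  shows "msum t 0 N ks = (\<Sum>a\<le>length ks. msum t M N (take a ks) * msum t 0 M (drop a ks))"
  using assms
proof (induction ks arbitrary: N)
  case Nil
  show ?case by simp
next
  case (Cons k ks)
  have "{0<..N} = {0<..M} \<union> {M<..N}" using Cons.prems by auto
  then have "msum t 0 N (k # ks) = msum t 0 M (k # ks) +
      (\<Sum>m\<in>{M<..N}. t k m * msum t 0 (m - 1) ks)"
    by (simp add: sum.union_disjoint)
  also have "(\<Sum>m\<in>{M<..N}. t k m * msum t 0 (m - 1) ks) =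
     (\<Sum>m\<in>{M<..N}. \<Sum>a\<le>length ks. t k m * (msum t M (m - 1) (take a ks) * msum t 0 M (drop a ks)))"
    by (intro sum.cong refl, subst Cons.IH) (use Cons.prems in \<open>auto simp: sum_distrib_left\<close>)
  also have "\<dots> = (\<Sum>a\<le>length ks. msum t M N (take (Suc a) (k # ks)) * msum t 0 M (drop (Suc a) (k # ks)))"
    by (subst sum.swap) (simp add: sum_distrib_right mult.assoc)
  finally show ?case
    by (simp add: sum.atMost_Suc_shift del: sum.atMost_Suc)
qed

lemma msum_snoc:
  "msum t M N (ks @ [k]) = (\<Sum>m\<in>{M<..N}. msum t m N ks * t k m)"
proof (induction ks arbitrary: N)
  case Nil
  show ?case by simp
next
  case (Cons l ks)
  have "msum t M N ((l # ks) @ [k]) =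
      (\<Sum>m'\<in>{M<..N}. \<Sum>m\<in>{M<..m' - 1}. t l m' * msum t m (m' - 1) ks * t k m)"
    by (simp add: Cons.IH sum_distrib_left mult.assoc)
  also have "\<dots> = (\<Sum>m'\<in>{M<..N}. \<Sum>m | m \<in> {M<..N} \<and> m < m'. t l m' * msum t m (m' - 1) ks * t k m)"
    by (intro sum.cong refl) auto
  also have "\<dots> = (\<Sum>m\<in>{M<..N}. \<Sum>m' | m' \<in> {M<..N} \<and> m < m'. t l m' * msum t m (m' - 1) ks * t k m)"
    by (rule sum.swap_restrict) auto
  also have "\<dots> = (\<Sum>m\<in>{M<..N}. \<Sum>m'\<in>{m<..N}. t l m' * msum t m (m' - 1) ks * t k m)"
    by (intro sum.cong refl) auto
  finally show ?case by (simp add: sum_distrib_right)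
qed

text \<open>The substitution \<open>m \<mapsto> n - m\<close> reverses the chain of inequalities, and so the index.\<close>
lemma msum_reflect:
  assumes "M < n"
  shows "msum t M (n - 1) (rev ks) = msum (\<lambda>k m. t k (n - m)) 0 (n - 1 - M) ks"
  using assms
proof (induction ks arbitrary: M)
  case Nil
  show ?case by simp
next
  case (Cons k ks)
  have "msum t M (n - 1) (rev (k # ks)) =
      (\<Sum>m\<in>{M<..n - 1}. msum (\<lambda>k m. t k (n - m)) 0 (n - 1 - m) ks * t k m)"
    by (simp add: msum_snoc) (intro sum.cong refl arg_cong2[where f="(*)"], use Cons in auto)
  also have "\<dots> = (\<Sum>m\<in>{0<..n - 1 - M}. msum (\<lambda>k m. t k (n - m)) 0 (m - 1) ks * t k (n - m))"
    by (rule sum.reindex_bij_witness[of _ "\<lambda>m. n - m" "\<lambda>m. n - m"]) (use Cons.prems in auto)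
  finally show ?case by (simp add: mult.commute)
qed

text \<open>The three sums collect the pairs whose first entry is the larger one, whose second entry is
  the larger one, and the diagonal: the combinatorial source of the stuffle product.\<close>
lemma sum_mult_sum_split:
  fixes a b :: "nat \<Rightarrow> 'a::comm_ring_1"
  shows "(\<Sum>m\<in>{0<..n}. a m) * (\<Sum>m\<in>{0<..n}. b m) =
    (\<Sum>m\<in>{0<..n}. a m * (\<Sum>j\<in>{0<..m - 1}. b j)) + (\<Sum>m\<in>{0<..n}. b m * (\<Sum>j\<in>{0<..m - 1}. a j))
    + (\<Sum>m\<in>{0<..n}. a m * b m)"
proof (induction n)
  case (Suc n)
  have *: "{0<..Suc n} = insert (Suc n) {0<..n}" by auto
  show ?case unfolding * using Suc by (simp add: algebra_simps)
qed simp

text \<open>Letters that multiply as \<open>t\<^sub>k t\<^sub>l = t\<^bsub>k+l\<^esub>\<close> up to \<open>\<delta>\<close>, dominated by one weight \<open>b\<close> for all \<open>k\<close>.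
  With \<open>b\<close> of total mass \<open>O(log N)\<close> every multiple sum is bounded by a power of the logarithm, while
  \<open>\<delta>\<close> is \<open>0\<close> for the harmonic letters and \<open>O(1/n)\<close> for those at a root of unity.\<close>
locale approx_letters =
  fixes t :: "nat \<Rightarrow> nat \<Rightarrow> 'a::real_normed_field" and b :: "nat \<Rightarrow> real"
    and \<delta> B :: real and N :: nat
  assumes letter_bound: "\<And>k m. 1 \<le> k \<Longrightarrow> 0 < m \<Longrightarrow> m \<le> N \<Longrightarrow> norm (t k m) \<le> b m"
    and letter_mult: "\<And>k l m. 1 \<le> k \<Longrightarrow> 1 \<le> l \<Longrightarrow> 0 < m \<Longrightarrow> m \<le> N \<Longrightarrow>
        norm (t k m * t l m - t (k + l) m) \<le> \<delta> * b m"
    and delta_nonneg: "0 \<le> \<delta>"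
    and weight_sum: "(\<Sum>m\<in>{0<..N}. b m) \<le> B"
begin

lemma weight_nonneg: "0 < m \<Longrightarrow> m \<le> N \<Longrightarrow> 0 \<le> b m"
  using order_trans[OF norm_ge_zero letter_bound[of 1 m]] by simp

lemma weight_sum_le: "n \<le> N \<Longrightarrow> (\<Sum>m\<in>{0<..n}. b m) \<le> B"
  by (rule order_trans[OF sum_mono2 weight_sum]) (auto intro: weight_nonneg)

lemma B_nonneg: "0 \<le> B"
  using weight_sum_le[of 0] by simp

lemma norm_letter_sum_le:
  fixes a c :: "nat \<Rightarrow> 'a"
  assumes "n \<le> N" "0 \<le> C"
    and "\<And>m. 0 < m \<Longrightarrow> m \<le> n \<Longrightarrow> norm (c m) \<le> C" "\<And>m. 0 < m \<Longrightarrow> m \<le> n \<Longrightarrow> norm (a m) \<le> b m"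
  shows "norm (\<Sum>m\<in>{0<..n}. a m * c m) \<le> B * C"
proof -
  have "norm (a m * c m) \<le> b m * C" if "m \<in> {0<..n}" for m
    unfolding norm_mult using that assms weight_nonneg[of m] by (intro mult_mono) auto
  then have "norm (\<Sum>m\<in>{0<..n}. a m * c m) \<le> (\<Sum>m\<in>{0<..n}. b m * C)"
    by (rule sum_norm_le)
  also have "\<dots> \<le> B * C"
    using weight_sum_le[OF assms(1)] assms(2) by (simp add: sum_distrib_right[symmetric] mult_right_mono)
  finally show ?thesis .
qed

lemma norm_msum_le: "is_index ks \<Longrightarrow> n \<le> N \<Longrightarrow> norm (msum t 0 n ks) \<le> B ^ length ks"
proof (induction ks arbitrary: n)
  case (Cons k ks)
  have "norm (\<Sum>m\<in>{0<..n}. t k m * msum t 0 (m - 1) ks) \<le> B * B ^ length ks"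
    using Cons by (intro norm_letter_sum_le letter_bound) (auto simp: B_nonneg)
  then show ?case by simp
qed simp

lemma norm_star_msum_le: "is_index ks \<Longrightarrow> n \<le> N \<Longrightarrow> norm (star_msum t n ks) \<le> B ^ length ks"
proof (induction ks arbitrary: n)
  case (Cons k ks)
  have "norm (\<Sum>m\<in>{0<..n}. t k m * star_msum t m ks) \<le> B * B ^ length ks"
    using Cons by (intro norm_letter_sum_le letter_bound) (auto simp: B_nonneg)
  then show ?case by simp
qed simp

lemma norm_letter_defect_sum_le:
  fixes c :: "nat \<Rightarrow> 'a"
  assumes "1 \<le> k" "1 \<le> l" "n \<le> N" "0 \<le> C" "\<And>m. 0 < m \<Longrightarrow> m \<le> n \<Longrightarrow> norm (c m) \<le> C"
  shows "norm (\<Sum>m\<in>{0<..n}. (t k m * t l m - t (k + l) m) * c m) \<le> \<delta> * (B * C)"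
proof -
  have "norm (\<Sum>m\<in>{0<..n}. (t k m * t l m - t (k + l) m) * c m) \<le> (\<Sum>m\<in>{0<..n}. \<delta> * b m * C)"
    by (rule sum_norm_le)
       (use assms letter_mult delta_nonneg weight_nonneg in \<open>auto simp: norm_mult intro!: mult_mono\<close>)
  also have "\<dots> = \<delta> * ((\<Sum>m\<in>{0<..n}. b m) * C)"
    by (simp add: sum_distrib_left sum_distrib_right mult.assoc)
  also have "\<dots> \<le> \<delta> * (B * C)"
    using weight_sum_le[OF assms(3)] assms(4) delta_nonneg by (intro mult_left_mono mult_right_mono)
  finally show ?thesis .
qed

lemma power_B_le: "i \<le> j \<Longrightarrow> B ^ i \<le> (4 * (1 + B)) ^ j"
  by (rule order_trans[OF power_mono[of B "4 * (1 + B)"] power_increasing]) (use B_nonneg in auto)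

text \<open>The defect satisfies the recursion of the stuffle product, with the diagonal terms
  \<open>t\<^sub>k t\<^sub>l - t\<^bsub>k+l\<^esub>\<close> as the only source; the constant \<open>4\<close> pays for the four sums in that recursion. For
  \<open>\<delta> = 0\<close> the stuffle product holds exactly.\<close>
lemma msum_stuffle_approx:
  assumes "is_index u" "is_index v" "n \<le> N"
  shows "norm (msum t 0 n u * msum t 0 n v - lin_eval (msum t 0 n) (stuffle_words u v))
     \<le> \<delta> * (4 * (1 + B)) ^ (length u + length v)"
  using assms
proof (induction u v arbitrary: n rule: stuffle_words.induct)
  case (3 k u l v)
  define c where "c = 4 * (1 + B)"
  have c: "1 \<le> c" "4 * B \<le> c" using B_nonneg by (auto simp: c_def)
  define L where "L = length u + length v"
  let ?S = "msum t 0" and ?E = "\<lambda>n u v. msum t 0 n u * msum t 0 n v - lin_eval (msum t 0 n) (stuffle_words u v)"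
  have kl: "1 \<le> k" "1 \<le> l" "is_index u" "is_index v" using 3 by auto
  have lin: "lin_eval (?S n) (prepend j f) = (\<Sum>m\<in>{0<..n}. t j m * lin_eval (?S (m - 1)) f)" for j f
  proof -
    have "Poly_Mapping.keys f \<subseteq> UNIV" by simp
    then show ?thesis
      by (induction rule: word_poly_induct)
         (auto simp: prepend_add prepend_scale lin_eval_add lin_eval_scale algebra_simps
            sum.distrib sum_distrib_left, simp add: prepend_def)
  qed
  have "?E n (k # u) (l # v) =
      (\<Sum>m\<in>{0<..n}. t k m * ?E (m - 1) u (l # v)) + (\<Sum>m\<in>{0<..n}. t l m * ?E (m - 1) (k # u) v)
      + (\<Sum>m\<in>{0<..n}. (t k m * t l m - t (k + l) m) * (?S (m - 1) u * ?S (m - 1) v))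
      + (\<Sum>m\<in>{0<..n}. t (k + l) m * ?E (m - 1) u v)"
    unfolding stuffle_words.simps lin_eval_add lin msum.simps sum_mult_sum_split
    by (simp add: algebra_simps sum.distrib sum_subtractf sum_distrib_left)
  also have "norm \<dots> \<le> B * (\<delta> * c ^ (L + 1)) + B * (\<delta> * c ^ (L + 1))
      + \<delta> * (B * (B ^ length u * B ^ length v)) + B * (\<delta> * c ^ L)"
  proof (intro norm_triangle_le add_mono norm_letter_sum_le norm_letter_defect_sum_le)
    fix m assume m: "0 < m" "m \<le> n"
    show "norm (?E (m - 1) u (l # v)) \<le> \<delta> * c ^ (L + 1)"
      using "3.IH"(1)[of "m - 1"] 3 m by (simp add: c_def L_def)
    show "norm (?E (m - 1) (k # u) v) \<le> \<delta> * c ^ (L + 1)"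
      using "3.IH"(2)[of "m - 1"] 3 m by (simp add: c_def L_def)
    show "norm (?E (m - 1) u v) \<le> \<delta> * c ^ L"
      using "3.IH"(3)[of "m - 1"] 3 m by (simp add: c_def L_def)
    show "norm (?S (m - 1) u * ?S (m - 1) v) \<le> B ^ length u * B ^ length v"
      unfolding norm_mult using 3 m by (intro mult_mono norm_msum_le) (auto simp: B_nonneg)
  qed (use 3 kl c delta_nonneg B_nonneg in \<open>auto intro!: letter_bound\<close>)
  also have "\<dots> = \<delta> * (B * (2 * c ^ (L + 1) + B ^ L + c ^ L))"
    by (simp add: algebra_simps L_def power_add)
  also have "\<dots> \<le> \<delta> * (B * (4 * c ^ (L + 1)))"
  proof -
    have "B ^ L \<le> c ^ (L + 1)" unfolding c_def by (rule power_B_le) simp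
    moreover have "c ^ L \<le> c ^ (L + 1)" using c by (intro power_increasing) auto
    ultimately show ?thesis using delta_nonneg B_nonneg by (intro mult_left_mono) auto
  qed
  also have "\<dots> \<le> \<delta> * (c * c ^ (L + 1))"
    using c delta_nonneg mult_right_mono[OF c(2), of "c ^ (L + 1)"]
    by (intro mult_left_mono) (auto simp: algebra_simps)
  finally show ?case by (simp add: c_def L_def)
qed (use delta_nonneg B_nonneg in auto)

end

text \<open>The passage from strict to star sums: \<open>g\<close> summed over all ways of merging adjacent entries.\<close>
definition fill_sum :: "(nat list \<Rightarrow> 'a::comm_monoid_add) \<Rightarrow> nat list \<Rightarrow> 'a" where
  "fill_sum g ks = (\<Sum>s | length s = length ks - 1. g (fill s ks))"

lemma finite_separator_lists: "finite {s :: separator list. length s = n}"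
proof -
  have "(UNIV :: separator set) \<subseteq> {Comma, Plus}" using separator.exhaust by auto
  then have "finite (UNIV :: separator set)" by (rule finite_subset) simp
  from finite_lists_length_eq[OF this, of n] show ?thesis by simp
qed

lemma fill_sum_simps [simp]:
  "fill_sum g [] = g []" "fill_sum g [k] = g [k]"
  "fill_sum g (k # l # ks) = fill_sum (\<lambda>v. g (k # v)) (l # ks) + fill_sum g ((k + l) # ks)"
proof -
  have 0: "{s :: separator list. length s = 0} = {[]}" by auto
  show "fill_sum g [] = g []" "fill_sum g [k] = g [k]" by (auto simp: fill_sum_def 0)
  let ?A = "{s :: separator list. length s = length ks}"
  have A: "{s :: separator list. length s = length (k # l # ks) - 1} = (#) Comma ` ?A \<union> (#) Plus ` ?A"
  proof (intro equalityI subsetI)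
    fix s :: "separator list" assume "s \<in> {s. length s = length (k # l # ks) - 1}"
    then obtain x s' where "s = x # s'" "s' \<in> ?A" by (cases s) auto
    then show "s \<in> (#) Comma ` ?A \<union> (#) Plus ` ?A" by (cases x) auto
  qed auto
  show "fill_sum g (k # l # ks) = fill_sum (\<lambda>v. g (k # v)) (l # ks) + fill_sum g ((k + l) # ks)"
    unfolding fill_sum_def A
    by (subst sum.union_disjoint) (auto simp: finite_separator_lists sum.reindex)
qed

lemma is_index_fill: "is_index ks \<Longrightarrow> is_index (fill s ks)"
  by (induction s ks rule: fill.induct) auto

lemma fill_sum_msum:
  "fill_sum (\<lambda>v. msum t 0 n (k # v)) ks = (\<Sum>m\<in>{0<..n}. t k m * fill_sum (msum t 0 (m - 1)) ks)"
  by (simp add: fill_sum_def sum_distrib_left) (rule sum.swap)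

context approx_letters
begin

text \<open>In a weak chain the first inequality is either strict or an equality. Equality multiplies
  two letters at the same point, which up to \<open>\<delta>\<close> is the letter of the merged entry.\<close>
lemma star_msum_approx:
  assumes "is_index ks" "n \<le> N"
  shows "norm (star_msum t n ks - fill_sum (msum t 0 n) ks) \<le> \<delta> * (4 * (1 + B)) ^ length ks"
  using assms
proof (induction "length ks" arbitrary: ks n)
  case 0
  then show ?case using delta_nonneg by simp
next
  case (Suc L)
  note IH = Suc(1)
  show ?case
  proof (cases "L = 0")
    case True
    then obtain k where "ks = [k]" using Suc(2) by (cases ks) auto
    then show ?thesis using delta_nonneg B_nonneg by simp
  next
    case False
    then obtain k l w where ks: "ks = k # l # w" using Suc
      by (cases ks; cases "tl ks") auto
    then have kl: "1 \<le> k" "1 \<le> l" "is_index w" "L = Suc (length w)" using Suc by auto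
    define c where "c = 4 * (1 + B)"
    have c: "1 \<le> c" "2 + 2 * B \<le> c" using B_nonneg by (auto simp: c_def)
    let ?E = "\<lambda>n ks. star_msum t n ks - fill_sum (msum t 0 n) ks"
    have step: "star_msum t m (l # w) = star_msum t (m - 1) (l # w) + t l m * star_msum t m w"
      if "0 < m" for m
    proof -
      have "{0<..m} = insert m {0<..m - 1}" using that by auto
      then show ?thesis using that by (simp add: algebra_simps)
    qed
    have "star_msum t n ks = (\<Sum>m\<in>{0<..n}. t k m * star_msum t m (l # w))"
      by (simp add: ks)
    also have "\<dots> = (\<Sum>m\<in>{0<..n}. t k m * (star_msum t (m - 1) (l # w) + t l m * star_msum t m w))"
      by (intro sum.cong refl, subst step) auto
    finally have "?E n ks = (\<Sum>m\<in>{0<..n}. t k m * ?E (m - 1) (l # w)) + ?E n ((k + l) # w)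
      + (\<Sum>m\<in>{0<..n}. (t k m * t l m - t (k + l) m) * star_msum t m w)"
      unfolding ks fill_sum_simps fill_sum_msum
      by (simp add: algebra_simps sum.distrib sum_subtractf)
    also have "norm \<dots> \<le> B * (\<delta> * c ^ L) + \<delta> * c ^ L + \<delta> * (B * B ^ length w)"
    proof (intro norm_triangle_le add_mono norm_letter_sum_le norm_letter_defect_sum_le)
      fix m assume m: "0 < m" "m \<le> n"
      show "norm (?E (m - 1) (l # w)) \<le> \<delta> * c ^ L"
        using IH[of "l # w" "m - 1"] Suc m kl unfolding ks c_def by simp
      show "norm (star_msum t m w) \<le> B ^ length w"
        using m Suc kl by (intro norm_star_msum_le) auto
    next
      show "norm (?E n ((k + l) # w)) \<le> \<delta> * c ^ L"
        using IH[of "(k + l) # w" n] Suc kl unfolding ks c_def by simp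
    qed (use Suc kl c delta_nonneg B_nonneg in \<open>auto intro!: letter_bound\<close>)
    also have "\<dots> = \<delta> * (B * c ^ L + c ^ L + B ^ L)" by (simp add: algebra_simps kl)
    also have "\<dots> \<le> \<delta> * ((2 + 2 * B) * c ^ L)"
    proof -
      have "B ^ L \<le> c ^ L" unfolding c_def by (rule power_B_le) simp
      moreover have "0 \<le> B * c ^ L" using B_nonneg c by simp
      ultimately show ?thesis using delta_nonneg by (intro mult_left_mono) (auto simp: algebra_simps)
    qed
    also have "\<dots> \<le> \<delta> * (c * c ^ L)" using c delta_nonneg by (intro mult_left_mono mult_right_mono) auto
    finally show ?thesis using kl by (simp add: c_def ks)
  qed
qed

end

section \<open>Errors smaller than every power of the logarithm\<close>

text \<open>Bounds are measured against the harmonic numbers instead of \<open>ln n\<close>, since they are the values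
  on the index \<open>(1)\<close> themselves and are at least 1 for positive \<open>n\<close>.\<close>
definition log_bounded :: "(nat \<Rightarrow> 'a::real_normed_field) \<Rightarrow> bool" where
  "log_bounded x \<longleftrightarrow> (\<exists>C j. \<forall>\<^sub>F n in sequentially. norm (x n) \<le> C * harm n ^ j)"

text \<open>Convergence to \<open>0\<close> alone would not be stable under multiplication by the divergent sums;
  the log-negligible sequences form an ideal in the ring of log-bounded ones.\<close>
definition log_negligible :: "(nat \<Rightarrow> 'a::real_normed_field) \<Rightarrow> bool" where
  "log_negligible e \<longleftrightarrow> (\<forall>j. (\<lambda>n. harm n ^ j * norm (e n)) \<longlonglongrightarrow> 0)"

lemma harm_ge_1: "1 \<le> n \<Longrightarrow> 1 \<le> (harm n :: real)"
  using harm_mono[of 1 n, where 'a=real] by (simp add: harm_def)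

lemma log_negligible_bound:
  assumes "log_negligible f" "\<forall>\<^sub>F n in sequentially. norm (e n) \<le> norm (f n)"
  shows "log_negligible e"
  unfolding log_negligible_def
proof
  fix j
  from assms(2) have "\<forall>\<^sub>F n in sequentially. norm (harm n ^ j * norm (e n)) \<le> harm n ^ j * norm (f n)"
    by eventually_elim (auto simp: abs_mult harm_nonneg intro!: mult_left_mono)
  then show "(\<lambda>n. harm n ^ j * norm (e n)) \<longlonglongrightarrow> 0"
    by (rule Lim_null_comparison) (use assms(1) in \<open>simp add: log_negligible_def\<close>)
qed

lemma log_negligible_0 [simp]: "log_negligible (\<lambda>n. 0)"
  by (simp add: log_negligible_def)

lemma log_negligible_add: 
  assumes "log_negligible e" "log_negligible f"
  shows "log_negligible (\<lambda>n. e n + f n)"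
  unfolding log_negligible_def
proof
  fix j
  have *: "(\<lambda>n. harm n ^ j * norm (e n) + harm n ^ j * norm (f n)) \<longlonglongrightarrow> 0"
    using tendsto_add[of _ 0 _ _ 0] assms unfolding log_negligible_def by fastforce
  show "(\<lambda>n. harm n ^ j * norm (e n + f n)) \<longlonglongrightarrow> 0"
    by (rule Lim_null_comparison[OF _ *])
       (auto simp: abs_mult harm_nonneg distrib_left[symmetric] intro!: always_eventually mult_left_mono norm_triangle_ineq)
qed

lemma log_negligible_minus: "log_negligible e \<Longrightarrow> log_negligible (\<lambda>n. - e n)"
  by (simp add: log_negligible_def)

lemma log_negligible_diff: "log_negligible e \<Longrightarrow> log_negligible f \<Longrightarrow> log_negligible (\<lambda>n. e n - f n)"
  using log_negligible_add[of e "\<lambda>n. - f n"] log_negligible_minus[of f] by simp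

lemma log_negligible_mult:
  assumes "log_negligible e" "log_bounded x"
  shows "log_negligible (\<lambda>n. e n * x n)"
  unfolding log_negligible_def
proof
  fix j
  obtain C i where Ci: "\<forall>\<^sub>F n in sequentially. norm (x n) \<le> C * harm n ^ i"
    using assms(2) unfolding log_bounded_def by blast
  have *: "(\<lambda>n. C * (harm n ^ (j + i) * norm (e n))) \<longlonglongrightarrow> 0"
    using assms(1) unfolding log_negligible_def by (intro tendsto_mult_right_zero) auto
  from Ci have "\<forall>\<^sub>F n in sequentially. norm (harm n ^ j * norm (e n * x n)) \<le> C * (harm n ^ (j + i) * norm (e n))"
  proof eventually_elim
    case (elim n)
    have "harm n ^ j * norm (e n) * norm (x n) \<le> harm n ^ j * norm (e n) * (C * harm n ^ i)"
      using elim by (intro mult_left_mono) (auto simp: harm_nonneg)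
    then show ?case by (simp add: norm_mult abs_mult harm_nonneg power_add mult_ac)
  qed
  then show "(\<lambda>n. harm n ^ j * norm (e n * x n)) \<longlonglongrightarrow> 0"
    by (rule Lim_null_comparison[OF _ *])
qed

lemma log_bounded_const: "log_bounded (\<lambda>n. c)"
  unfolding log_bounded_def by (intro exI[of _ "norm c"] exI[of _ 0]) simp

lemma log_negligible_cmult: "log_negligible e \<Longrightarrow> log_negligible (\<lambda>n. c * e n)"
  using log_negligible_mult[OF _ log_bounded_const[of c]] by (simp add: mult.commute)

lemma log_negligible_sum: "(\<And>a. a \<in> A \<Longrightarrow> log_negligible (e a)) \<Longrightarrow> log_negligible (\<lambda>n. \<Sum>a\<in>A. e a n)"
  by (induction A rule: infinite_finite_induct) (auto intro: log_negligible_add)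

lemma log_negligible_tendsto: "log_negligible e \<Longrightarrow> e \<longlonglongrightarrow> 0"
  using tendsto_norm_zero_cancel[of e] unfolding log_negligible_def by (auto dest: spec[of _ 0])

lemma log_negligible_of_real: "log_negligible (\<lambda>n. of_real (e n) :: 'a::real_normed_field) \<longleftrightarrow> log_negligible e"
  by (simp add: log_negligible_def)

lemma log_bounded_nonneg_const:
  assumes "log_bounded x"
  obtains C j where "0 \<le> C" "\<forall>\<^sub>F n in sequentially. norm (x n) \<le> C * harm n ^ j"
proof -
  obtain C j where "\<forall>\<^sub>F n in sequentially. norm (x n) \<le> C * harm n ^ j"
    using assms unfolding log_bounded_def by blast
  then have "\<forall>\<^sub>F n in sequentially. norm (x n) \<le> max C 0 * harm n ^ j"
    by eventually_elim (auto elim!: order_trans simp: harm_nonneg intro!: mult_right_mono)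
  then show ?thesis by (intro that[of "max C 0" j]) auto
qed

lemma log_bounded_add:
  assumes "log_bounded x" "log_bounded y"
  shows "log_bounded (\<lambda>n. x n + y n)"
proof -
  from log_bounded_nonneg_const[OF assms(1)] obtain C i
    where 1: "0 \<le> C" "\<forall>\<^sub>F n in sequentially. norm (x n) \<le> C * harm n ^ i" .
  from log_bounded_nonneg_const[OF assms(2)] obtain D j
    where 2: "0 \<le> D" "\<forall>\<^sub>F n in sequentially. norm (y n) \<le> D * harm n ^ j" .
  have "\<forall>\<^sub>F n in sequentially. norm (x n + y n) \<le> (C + D) * harm n ^ (i + j)"
    using 1(2) 2(2) eventually_ge_at_top[of 1]
  proof eventually_elim
    case (elim n)
    have "harm n ^ i \<le> (harm n ^ (i + j) :: real)" "harm n ^ j \<le> (harm n ^ (i + j) :: real)"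
      using harm_ge_1[OF elim(3)] by (auto intro: power_increasing)
    then have "C * harm n ^ i + D * harm n ^ j \<le> (C + D) * harm n ^ (i + j)"
      using 1(1) 2(1) by (auto simp: distrib_right intro!: add_mono mult_left_mono)
    then show ?case using elim norm_triangle_ineq[of "x n" "y n"] by linarith
  qed
  then show ?thesis unfolding log_bounded_def by blast
qed

lemma log_bounded_mult:
  assumes "log_bounded x" "log_bounded y"
  shows "log_bounded (\<lambda>n. x n * y n)"
proof -
  from log_bounded_nonneg_const[OF assms(1)] obtain C i
    where 1: "0 \<le> C" "\<forall>\<^sub>F n in sequentially. norm (x n) \<le> C * harm n ^ i" .
  from log_bounded_nonneg_const[OF assms(2)] obtain D j
    where 2: "0 \<le> D" "\<forall>\<^sub>F n in sequentially. norm (y n) \<le> D * harm n ^ j" .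
  have "\<forall>\<^sub>F n in sequentially. norm (x n * y n) \<le> (C * D) * harm n ^ (i + j)"
    using 1(2) 2(2)
  proof eventually_elim
    case (elim n)
    have "norm (x n) * norm (y n) \<le> (C * harm n ^ i) * (D * harm n ^ j)"
      using elim 1(1) 2(1) by (intro mult_mono) (auto simp: harm_nonneg)
    then show ?case by (simp add: norm_mult power_add mult_ac)
  qed
  then show ?thesis unfolding log_bounded_def by blast
qed

lemma log_negligible_imp_log_bounded:
  assumes "log_negligible e" shows "log_bounded e"
proof -
  have "\<forall>\<^sub>F n in sequentially. norm (e n) < 1"
    using order_tendstoD(2)[OF tendsto_norm_zero[OF log_negligible_tendsto[OF assms]], of 1] by simp
  then show ?thesis unfolding log_bounded_def
    by (intro exI[of _ 1] exI[of _ 0]) (auto elim: eventually_mono)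
qed

lemma log_negligible_mult_cong:
  assumes "log_negligible (\<lambda>n. x n - x' n)" "log_negligible (\<lambda>n. y n - y' n)" "log_bounded x'" "log_bounded y'"
  shows "log_negligible (\<lambda>n. x n * y n - x' n * y' n)"
proof -
  have "log_bounded (\<lambda>n. (y n - y' n) + y' n)"
    by (intro log_bounded_add log_negligible_imp_log_bounded assms)
  then have "log_bounded y" by simp
  from log_negligible_add[OF log_negligible_mult[OF assms(1) this] log_negligible_mult[OF assms(2,3)]]
  show ?thesis by (simp add: algebra_simps)
qed

lemma log_bounded_poly: "log_bounded x \<Longrightarrow> log_bounded (\<lambda>n. poly p (x n))"
  by (induction p) (auto intro: log_bounded_add log_bounded_mult log_bounded_const)

lemma log_negligible_poly_cong:
  assumes "log_negligible (\<lambda>n. x n - x' n)" "log_bounded x'"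
  shows "log_negligible (\<lambda>n. poly p (x n) - poly p (x' n))"
proof (induction p)
  case (pCons a p)
  show ?case using log_negligible_mult_cong[OF assms(1) pCons(2) assms(2) log_bounded_poly[OF assms(2)]]
    by simp
qed simp

lemma log_bounded_harm: "log_bounded (\<lambda>n. harm n)"
  unfolding log_bounded_def by (intro exI[of _ 1] exI[of _ "1::nat"] always_eventually) (simp add: norm_harm)

lemma harm_power_over_n: "(\<lambda>n. harm n ^ j / real n) \<longlonglongrightarrow> (0::real)"
proof -
  obtain C where C: "\<And>n. \<bar>harm n - ln (real n)\<bar> \<le> C"
    using convergent_imp_Bseq[OF euler_mascheroni_convergent] unfolding Bseq_def by auto
  have "filterlim (\<lambda>n. C + ln (real n)) at_top sequentially"
    by (intro filterlim_tendsto_add_at_top[OF tendsto_const]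
        filterlim_compose[OF ln_at_top filterlim_real_sequentially])
  from filterlim_compose[OF tendsto_power_div_exp_0 this]
  have "(\<lambda>n. exp C * ((C + ln (real n)) ^ j / exp (C + ln (real n)))) \<longlonglongrightarrow> 0"
    by (rule tendsto_mult_right_zero)
  moreover have "\<forall>\<^sub>F n in sequentially. exp C * ((C + ln (real n)) ^ j / exp (C + ln (real n)))
      = (C + ln (real n)) ^ j / real n"
    using eventually_gt_at_top[of 0] by eventually_elim (simp add: exp_add)
  ultimately have *: "(\<lambda>n. (C + ln (real n)) ^ j / real n) \<longlonglongrightarrow> 0"
    by (rule Lim_transform_eventually)
  show ?thesis
  proof (rule Lim_null_comparison[OF _ *], intro always_eventually allI)
    fix n
    have "harm n ^ j \<le> (C + ln (real n)) ^ j" using C[of n] by (intro power_mono) (auto simp: harm_nonneg)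
    then show "norm (harm n ^ j / real n) \<le> (C + ln (real n)) ^ j / real n"
      by (simp add: harm_nonneg divide_right_mono)
  qed
qed

lemma log_negligible_inverse: "log_negligible (\<lambda>n. 1 / of_nat n)"
  using harm_power_over_n by (simp add: log_negligible_def norm_divide)

lemma summable_harm_power_over_square: "summable (\<lambda>n. harm n ^ j / real n ^ 2)"
proof (rule summable_comparison_test_ev)
  show "summable (\<lambda>n. real n powr (-3/2))" by (simp add: summable_real_powr_iff)
  have "\<forall>\<^sub>F n in sequentially. harm n ^ (2 * j) / real n < 1"
    using order_tendstoD(2)[OF harm_power_over_n, of 1 "2 * j"] by simp
  then show "\<forall>\<^sub>F n in sequentially. norm (harm n ^ j / real n ^ 2) \<le> real n powr (-3/2)"
    using eventually_gt_at_top[of 0]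
  proof eventually_elim
    case (elim n)
    have "(harm n ^ j)\<^sup>2 \<le> real n" using elim by (simp add: power_mult[symmetric] mult.commute field_simps)
    then have "harm n ^ j \<le> sqrt (real n)" by (rule real_le_rsqrt)
    also have "sqrt (real n) = real n powr (1/2)" using elim by (simp add: powr_half_sqrt)
    finally have "harm n ^ j / real n ^ 2 \<le> real n powr (1/2) / real n powr 2"
      using elim powr_realpow[of "real n" 2] by (simp add: divide_right_mono)
    also have "\<dots> = real n powr (-3/2)"
      using powr_diff[of "real n" "1/2" 2] by (simp del: powr_numeral)
    finally show ?case by (simp add: harm_nonneg)
  qed
qed

text \<open>The factor \<open>harm N ^ j\<close> can be moved inside the tail, where it is at most
  \<open>harm m ^ j\<close>; what results is the tail of another convergent series of the same kind.\<close>
lemma log_negligible_tail: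
  fixes a :: "nat \<Rightarrow> real"
  assumes a: "\<And>m. 0 \<le> a m" "\<And>m. a m \<le> harm m ^ i / real m ^ 2"
  shows "summable a" "log_negligible (\<lambda>N. (\<Sum>m\<in>{0<..N}. a m) - suminf a)"
proof -
  show sa: "summable a"
    by (rule summable_comparison_test'[OF summable_harm_power_over_square[of i]]) (use a in auto)
  have a0: "a 0 = 0" using a(1)[of 0] a(2)[of 0] by simp
  have tail: "suminf a - (\<Sum>m\<in>{0<..N}. a m) = suminf (\<lambda>m. a (m + Suc N))" for N :: nat
  proof -
    have "{..<Suc N} = insert 0 {0<..N}" by auto
    then have "(\<Sum>m<Suc N. a m) = (\<Sum>m\<in>{0<..N}. a m)" using a0 by simp
    then show ?thesis using suminf_minus_initial_segment[OF sa, of "Suc N"] by simp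
  qed
  show "log_negligible (\<lambda>N. (\<Sum>m\<in>{0<..N}. a m) - suminf a)"
    unfolding log_negligible_def
  proof
    fix j
    let ?s = "\<lambda>m. harm m ^ (j + i) / real m ^ 2 :: real"
    have ss: "summable ?s" by (rule summable_harm_power_over_square)
    have *: "(\<lambda>N. suminf (\<lambda>m. ?s (m + Suc N))) \<longlonglongrightarrow> 0"
      using LIMSEQ_Suc[OF suminf_exist_split2[OF ss]] by simp
    show "(\<lambda>N. harm N ^ j * norm ((\<Sum>m\<in>{0<..N}. a m) - suminf a)) \<longlonglongrightarrow> 0"
    proof (rule Lim_null_comparison[OF _ *], intro always_eventually allI)
      fix N
      have sN: "summable (\<lambda>m. a (m + Suc N))" "summable (\<lambda>m. ?s (m + Suc N))"
        using sa ss summable_ignore_initial_segment by blast+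
      have "norm ((\<Sum>m\<in>{0<..N}. a m) - suminf a) = suminf (\<lambda>m. a (m + Suc N))"
        using tail[of N] suminf_nonneg[OF sN(1)] a(1) by (simp add: abs_minus_commute)
      then have "harm N ^ j * norm ((\<Sum>m\<in>{0<..N}. a m) - suminf a) = suminf (\<lambda>m. harm N ^ j * a (m + Suc N))"
        by (simp only: suminf_mult[OF sN(1)])
      also have "\<dots> \<le> suminf (\<lambda>m. ?s (m + Suc N))"
      proof (rule suminf_le)
        fix m
        have "harm N ^ j * a (m + Suc N) \<le> harm (m + Suc N) ^ j * (harm (m + Suc N) ^ i / real (m + Suc N) ^ 2)"
          by (intro mult_mono power_mono harm_mono a) (auto simp: harm_nonneg a)
        then show "harm N ^ j * a (m + Suc N) \<le> ?s (m + Suc N)" by (simp add: power_add)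
      qed (use sN in \<open>auto intro: summable_mult\<close>)
      finally show "norm (harm N ^ j * norm ((\<Sum>m\<in>{0<..N}. a m) - suminf a)) \<le> suminf (\<lambda>m. ?s (m + Suc N))"
        by (simp add: abs_mult harm_nonneg)
    qed
  qed
qed

section \<open>Multiple harmonic sums and multiple zeta values\<close>

definition inv_letter :: "nat \<Rightarrow> nat \<Rightarrow> real" where
  "inv_letter k m = 1 / real m ^ k"

lemma harm_eq_sum: "harm N = (\<Sum>m\<in>{0<..N}. 1 / real m)"
  by (auto simp: harm_def inverse_eq_divide intro!: sum.cong)

lemma approx_letters_inv: "approx_letters inv_letter (\<lambda>m. 1 / real m) 0 (harm N) N"
proof
  fix k m :: nat assume "1 \<le> k" "0 < m" "m \<le> N"
  then have "real m ^ 1 \<le> real m ^ k" by (intro power_increasing) auto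
  then show "norm (inv_letter k m) \<le> 1 / real m"
    using \<open>0 < m\<close> by (simp add: inv_letter_def frac_le)
qed (auto simp: inv_letter_def power_add harm_eq_sum)

abbreviation hsum :: "nat \<Rightarrow> nat list \<Rightarrow> real" where
  "hsum N \<equiv> msum inv_letter 0 N"

lemma hsum_1: "hsum N [1] = harm N"
  by (simp add: harm_eq_sum inv_letter_def)

lemma hsum_nonneg: "0 \<le> hsum N ks"
  by (induction ks arbitrary: N) (auto intro!: sum_nonneg simp: inv_letter_def)

lemma hsum_le: "is_index ks \<Longrightarrow> hsum N ks \<le> harm N ^ length ks"
  using approx_letters.norm_msum_le[OF approx_letters_inv, of ks N N] hsum_nonneg[of N ks] by simp

lemma hsum_stuffle_words:
  "is_index u \<Longrightarrow> is_index v \<Longrightarrow> lin_eval (hsum N) (stuffle_words u v) = hsum N u * hsum N v"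
  using approx_letters.msum_stuffle_approx[OF approx_letters_inv, of u v N N] by simp

lemma hsum_stuffle:
  assumes "f \<in> H1" "g \<in> H1"
  shows "lin_eval (hsum N) (stuffle f g) = lin_eval (hsum N) f * lin_eval (hsum N) g"
proof -
  have "lin_eval (hsum N) (stuffle f g) = lin_eval (\<lambda>u. lin_eval (\<lambda>v. hsum N u * hsum N v) g) f"
    unfolding lin_eval_stuffle using assms
    by (intro lin_eval_cong hsum_stuffle_words) (auto simp: H1_def)
  also have "\<dots> = lin_eval (hsum N) f * lin_eval (hsum N) g"
    by (simp add: lin_eval_def sum_product) (simp add: sum_distrib_left mult_ac)
  finally show ?thesis .
qed

lemma hsum_tendsto_negligibly:
  assumes "admissible ks"
  shows "\<exists>z. log_negligible (\<lambda>N. hsum N ks - z)"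
proof (cases ks)
  case Nil
  then show ?thesis by (intro exI[of _ 1]) simp
next
  case (Cons k w)
  then have k: "2 \<le> k" "is_index w" using assms by (auto simp: admissible_def)
  define a where "a m = inv_letter k m * hsum (m - 1) w" for m
  have "0 \<le> a m" for m by (simp add: a_def inv_letter_def hsum_nonneg)
  moreover have "a m \<le> harm m ^ length w / real m ^ 2" for m
  proof (cases "m = 0")
    case False
    then have "real m ^ 2 \<le> real m ^ k" using k by (intro power_increasing) auto
    then have "inv_letter k m \<le> 1 / real m ^ 2" using False by (simp add: inv_letter_def frac_le)
    moreover have "hsum (m - 1) w \<le> harm m ^ length w"
      using hsum_le[OF k(2), of "m - 1"]
      by (rule order_trans) (auto intro!: power_mono harm_mono harm_nonneg)
    ultimately have "a m \<le> 1 / real m ^ 2 * harm m ^ length w"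
      unfolding a_def by (intro mult_mono) (auto simp: hsum_nonneg)
    then show ?thesis by simp
  qed (use k in \<open>auto simp: a_def inv_letter_def power_0_left\<close>)
  ultimately have "log_negligible (\<lambda>N. (\<Sum>m\<in>{0<..N}. a m) - suminf a)" by (rule log_negligible_tail)
  then show ?thesis unfolding Cons by (intro exI[of _ "suminf a"]) (simp add: a_def)
qed

text \<open>The sets of chains bounded by \<open>N\<close> exhaust the set of all chains, so the unordered sum is
  the limit of the truncated sums.\<close>
lemma hsum_mzv:
  assumes "admissible ks"
  shows "log_negligible (\<lambda>N. hsum N ks - mzv ks)"
proof -
  let ?D = "{ms :: nat list. length ms = length ks \<and> (\<forall>m\<in>set ms. 0 < m) \<and> sorted_wrt (>) ms}"
  let ?F = "\<lambda>N. {ms :: nat list. length ms = length ks \<and> set ms \<subseteq> {0<..N} \<and> sorted_wrt (>) ms}"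
  let ?f = "\<lambda>ms. \<Prod>j<length ks. 1 / real (ms ! j) ^ (ks ! j)"
  have hsum: "hsum N ks = sum ?f (?F N)" for N
    unfolding msum_eq_sum_lists inv_letter_def ..
  have finF: "finite (?F N)" for N :: nat
    by (rule finite_bounded_lists[of "length ks" 0 N "sorted_wrt (>)"])
  have subF: "?F N \<subseteq> ?D" for N by auto
  have cover: "\<exists>N0. \<forall>N\<ge>N0. X \<subseteq> ?F N" if X: "finite X" "X \<subseteq> ?D" for X
  proof -
    have "finite (\<Union>(set ` X))" using X(1) by simp
    then obtain N0 where N0: "\<And>ms m. ms \<in> X \<Longrightarrow> m \<in> set ms \<Longrightarrow> m \<le> N0"
      unfolding finite_nat_set_iff_bounded_le by blast
    have "ms \<in> ?F N" if "N0 \<le> N" "ms \<in> X" for N ms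
    proof -
      have "ms \<in> ?D" using X(2) that(2) by blast
      moreover have "m \<le> N" if "m \<in> set ms" for m
        using N0[OF \<open>ms \<in> X\<close> that] \<open>N0 \<le> N\<close> by simp
      ultimately show ?thesis by auto
    qed
    then show ?thesis by blast
  qed
  obtain z where z: "log_negligible (\<lambda>N. hsum N ks - z)" using hsum_tendsto_negligibly[OF assms] by blast
  then have lim: "(\<lambda>N. hsum N ks) \<longlonglongrightarrow> z"
    using log_negligible_tendsto Lim_null by fastforce
  have "Bseq (\<lambda>N. hsum N ks)" using lim by (intro convergent_imp_Bseq) (auto simp: convergent_def)
  then obtain C where C: "\<And>N. norm (hsum N ks) \<le> C" unfolding Bseq_def by auto
  have "?f summable_on ?D"
  proof (rule nonneg_bdd_above_summable_on)
    show "bdd_above (sum ?f ` {X. X \<subseteq> ?D \<and> finite X})"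
    proof (rule bdd_aboveI[of _ C], clarify)
      fix X assume "finite X" "X \<subseteq> ?D"
      then obtain N where "X \<subseteq> ?F N" using cover[of X] by auto
      then have "sum ?f X \<le> sum ?f (?F N)" by (intro sum_mono2 finF) (auto intro!: prod_nonneg)
      then show "sum ?f X \<le> C" using C[of N] hsum[of N] by simp
    qed
  qed (auto intro!: prod_nonneg)
  then have "(sum ?f \<longlongrightarrow> mzv ks) (finite_subsets_at_top ?D)"
    unfolding mzv_def has_sum_def[symmetric] by (rule has_sum_infsum)
  moreover have "filterlim ?F (finite_subsets_at_top ?D) sequentially"
    unfolding filterlim_def le_filter_def eventually_filtermap eventually_finite_subsets_at_top
  proof (intro allI impI, elim exE conjE)
    fix P X assume "finite X" "X \<subseteq> ?D" and P: "\<forall>Y. finite Y \<and> X \<subseteq> Y \<and> Y \<subseteq> ?D \<longrightarrow> P Y"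
    then obtain N0 where N0: "\<forall>N\<ge>N0. X \<subseteq> ?F N" using cover[of X] by auto
    have "P (?F N)" if "N0 \<le> N" for N
      by (rule P[rule_format]) (intro conjI finF subF N0[rule_format, OF that])
    then show "\<forall>\<^sub>F N in sequentially. P (?F N)"
      by (rule eventually_sequentiallyI)
  qed
  ultimately have "(\<lambda>N. sum ?f (?F N)) \<longlonglongrightarrow> mzv ks" by (rule filterlim_compose)
  then have "mzv ks = z" using lim unfolding hsum by (rule LIMSEQ_unique)
  then show ?thesis using z by simp
qed

lemma mzv_2: "mzv [2] = pi\<^sup>2 / 6"
proof -
  have "(\<lambda>N. hsum N [2]) \<longlonglongrightarrow> mzv [2]"
    using log_negligible_tendsto[OF hsum_mzv[of "[2]"]] Lim_null by (fastforce simp: admissible_def is_index_def)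
  moreover have "hsum N [2] = (\<Sum>n<N. 1 / (real n + 1)\<^sup>2)" for N
  proof -
    have "{0<..N} = Suc ` {..<N}" unfolding image_Suc_lessThan by auto
    then show ?thesis by (simp add: inv_letter_def sum.reindex add_ac)
  qed
  then have "(\<lambda>N. hsum N [2]) \<longlonglongrightarrow> pi\<^sup>2 / 6" using inverse_squares_sums by (simp add: sums_def add_ac)
  ultimately show ?thesis by (rule LIMSEQ_unique)
qed

section \<open>Stuffle regularization as an asymptotic expansion\<close>

text \<open>Polynomials in the harmonic numbers are determined by their growth; this makes the
  asymptotic expansion of a truncated sum unique.\<close>
lemma poly_harm_negligible_imp_0:
  fixes p :: "real poly"
  assumes "log_negligible (\<lambda>N. poly p (harm N))"
  shows "p = 0"
proof -
  have pos: False if neg: "log_negligible (\<lambda>N. poly q (harm N))" and lc: "lead_coeff q > 0" for q :: "real poly"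
  proof -
    obtain x0 where x0: "\<And>x. x0 \<le> x \<Longrightarrow> lead_coeff q \<le> poly q x"
      using poly_pinfty_gt_lc[OF lc] by blast
    have "\<forall>\<^sub>F N in sequentially. x0 \<le> (harm N :: real)"
      using harm_at_top by (simp add: filterlim_at_top)
    moreover have "\<forall>\<^sub>F N in sequentially. poly q (harm N) < lead_coeff q"
      by (rule order_tendstoD(2)[OF log_negligible_tendsto[OF neg] lc])
    ultimately have "\<forall>\<^sub>F N in sequentially. False"
      by eventually_elim (use x0 in force)
    then show False by simp
  qed
  have "\<not> lead_coeff p > 0" using pos[OF assms] by blast
  moreover have "\<not> lead_coeff (- p) > 0" using pos[of "- p"] log_negligible_minus[OF assms] by auto
  ultimately have "lead_coeff p = 0" by simp
  then show ?thesis by simp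
qed

text \<open>\<open>p\<close> describes the truncated harmonic sum of \<open>f\<close> as a polynomial in the harmonic number.
  Existence and uniqueness of \<open>p\<close> define the regularization, and multiplicativity is inherited from
  the exact stuffle product of truncated sums.\<close>
definition harmonic_asymp :: "word_poly \<Rightarrow> real poly \<Rightarrow> bool" where
  "harmonic_asymp f p \<longleftrightarrow> log_negligible (\<lambda>N. lin_eval (hsum N) f - poly p (harm N))"

lemma harmonic_asymp_unique: "harmonic_asymp f p \<Longrightarrow> harmonic_asymp f q \<Longrightarrow> p = q"
  using poly_harm_negligible_imp_0[of "p - q"] log_negligible_diff[of
      "\<lambda>N. lin_eval (hsum N) f - poly q (harm N)" "\<lambda>N. lin_eval (hsum N) f - poly p (harm N)"]
  by (simp add: harmonic_asymp_def)

lemma harmonic_asymp_add: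
  "harmonic_asymp f p \<Longrightarrow> harmonic_asymp g q \<Longrightarrow> harmonic_asymp (f + g) (p + q)"
  unfolding harmonic_asymp_def by (drule (1) log_negligible_add) (simp add: lin_eval_add algebra_simps)

lemma harmonic_asymp_scale:
  "harmonic_asymp f p \<Longrightarrow> harmonic_asymp (word_scale c f) (smult (of_rat c) p)"
  unfolding harmonic_asymp_def
  by (drule log_negligible_cmult[of _ "of_rat c"]) (simp add: lin_eval_scale algebra_simps)

lemma harmonic_asymp_stuffle:
  assumes "f \<in> H1" "g \<in> H1" "harmonic_asymp f p" "harmonic_asymp g q"
  shows "harmonic_asymp (stuffle f g) (p * q)"
  using assms log_negligible_mult_cong[of "\<lambda>N. lin_eval (hsum N) f" "\<lambda>N. poly p (harm N)"
      "\<lambda>N. lin_eval (hsum N) g" "\<lambda>N. poly q (harm N)"]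
  by (simp add: harmonic_asymp_def hsum_stuffle log_bounded_poly log_bounded_harm)

lemma harmonic_asymp_1: "harmonic_asymp (e_word [1]) [:0, 1:]"
  unfolding harmonic_asymp_def lin_eval_e_word hsum_1 by simp

lemma harmonic_asymp_admissible: "admissible ks \<Longrightarrow> harmonic_asymp (e_word ks) [:mzv ks:]"
  using hsum_mzv by (simp add: harmonic_asymp_def)

lemma harmonic_asymp_exists:
  assumes "f \<in> H1" shows "\<exists>p. harmonic_asymp f p"
  using assms
proof (induction rule: H1_induct)
  case (stuffle f)
  then obtain p where "harmonic_asymp f p" by blast
  then have "harmonic_asymp (Defs.stuffle (e_word [1]) f) ([:0, 1:] * p)"
    using stuffle by (intro harmonic_asymp_stuffle harmonic_asymp_1) auto
  then show ?case by blast
qed (blast intro: harmonic_asymp_admissible harmonic_asymp_add harmonic_asymp_scale)+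

lemma stuffle_hom_unique:
  assumes "stuffle_hom R" "stuffle_hom R'" "R (e_word [1]) = R' (e_word [1])"
    and "\<And>ks. admissible ks \<Longrightarrow> R (e_word ks) = R' (e_word ks)" and "f \<in> H1"
  shows "R f = R' f"
  using assms(5)
proof (induction rule: H1_induct)
  case (stuffle f)
  have "e_word [1] \<in> H1" by simp
  then show ?case using assms(1-3) stuffle unfolding stuffle_hom_def by metis
qed (use assms in \<open>auto simp: stuffle_hom_def\<close>)

lemma mzv_Nil: "mzv [] = 1"
proof -
  have "log_negligible (\<lambda>N. hsum N [] - mzv [])" by (rule hsum_mzv) (simp add: admissible_def)
  from log_negligible_tendsto[OF this] show ?thesis by (simp add: LIMSEQ_const_iff)
qed

definition harmonic_reg :: "word_poly \<Rightarrow> real poly" where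
  "harmonic_reg = restrict (\<lambda>f. THE p. harmonic_asymp f p) H1"

lemma harmonic_reg_eqI: "f \<in> H1 \<Longrightarrow> harmonic_asymp f p \<Longrightarrow> harmonic_reg f = p"
  unfolding harmonic_reg_def by (auto intro: the_equality harmonic_asymp_unique)

lemma harmonic_asymp_reg: "f \<in> H1 \<Longrightarrow> harmonic_asymp f (harmonic_reg f)"
  using harmonic_asymp_exists harmonic_reg_eqI by blast

lemma stuffle_hom_harmonic_reg: "stuffle_hom harmonic_reg"
  unfolding stuffle_hom_def
proof (intro conjI ballI allI)
  show "harmonic_reg (e_word []) = 1"
    using harmonic_reg_eqI[OF _ harmonic_asymp_admissible[of "[]"]]
    by (simp add: admissible_def mzv_Nil one_pCons)
qed (auto intro!: harmonic_reg_eqI H1_add H1_scale stuffle_in_H1 harmonic_asymp_add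
      harmonic_asymp_scale harmonic_asymp_stuffle harmonic_asymp_reg)

lemma stuffle_reg_eq: "stuffle_reg = harmonic_reg"
  unfolding stuffle_reg_def
proof (rule the_equality)
  have "harmonic_reg (e_word [1]) = [:0, 1:]"
    by (rule harmonic_reg_eqI[OF _ harmonic_asymp_1]) simp
  moreover have "harmonic_reg (e_word ks) = [:mzv ks:]" if "admissible ks" for ks
    by (rule harmonic_reg_eqI[OF _ harmonic_asymp_admissible[OF that]])
       (use that in \<open>simp add: admissible_def\<close>)
  moreover have "harmonic_reg \<in> extensional H1" by (simp add: harmonic_reg_def)
  ultimately show *: "harmonic_reg \<in> extensional H1 \<and> stuffle_hom harmonic_reg \<and>
      harmonic_reg (e_word [1]) = [:0, 1:] \<and> (\<forall>ks. admissible ks \<longrightarrow> harmonic_reg (e_word ks) = [:mzv ks:])"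
    using stuffle_hom_harmonic_reg by blast
  fix R :: "word_poly \<Rightarrow> real poly"
  assume R: "R \<in> extensional H1 \<and> stuffle_hom R \<and> R (e_word [1]) = [:0, 1:] \<and>
      (\<forall>ks. admissible ks \<longrightarrow> R (e_word ks) = [:mzv ks:])"
  with * have "R f = harmonic_reg f" if "f \<in> H1" for f
    using stuffle_hom_unique[of R harmonic_reg f] that by metis
  with * R show "R = harmonic_reg" by (intro extensionalityI[of R H1 harmonic_reg]) auto
qed

lemma stuffle_reg_add: "f \<in> H1 \<Longrightarrow> g \<in> H1 \<Longrightarrow> stuffle_reg (f + g) = stuffle_reg f + stuffle_reg g"
  and stuffle_reg_scale: "f \<in> H1 \<Longrightarrow> stuffle_reg (word_scale c f) = smult (of_rat c) (stuffle_reg f)"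
  and stuffle_reg_stuffle:
    "f \<in> H1 \<Longrightarrow> g \<in> H1 \<Longrightarrow> stuffle_reg (stuffle f g) = stuffle_reg f * stuffle_reg g"
  using stuffle_hom_harmonic_reg by (simp_all add: stuffle_reg_eq stuffle_hom_def)

lemma stuffle_reg_1: "stuffle_reg (e_word [1]) = [:0, 1:]"
  unfolding stuffle_reg_eq by (rule harmonic_reg_eqI[OF _ harmonic_asymp_1]) simp

lemma stuffle_reg_admissible: "admissible ks \<Longrightarrow> stuffle_reg (e_word ks) = [:mzv ks:]"
  unfolding stuffle_reg_eq
  by (rule harmonic_reg_eqI[OF _ harmonic_asymp_admissible]) (auto simp: admissible_def)

lemma stuffle_reg_0: "stuffle_reg 0 = 0"
  using stuffle_reg_scale[of 0 0] by simp

text \<open>Both \<open>d/dT\<close> after the regularization and the regularization after \<^const>\<open>drop_one\<close> are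
  derivations along the regularization. They vanish on admissible words and take \<open>e\<^sub>1\<close> to \<open>1\<close>.\<close>
lemma pderiv_stuffle_reg:
  assumes "f \<in> H1"
  shows "pderiv (stuffle_reg f) = stuffle_reg (drop_one f)"
  using assms
proof (induction rule: H1_induct)
  case (admissible w)
  then have "drop_one (e_word w) = 0"
    by (cases w) (auto simp: drop_one_e_word admissible_def)
  then show ?case using admissible by (simp add: stuffle_reg_admissible stuffle_reg_0)
next
  case (add f g)
  then show ?case by (simp add: stuffle_reg_add pderiv_add drop_one_add drop_one_in_H1)
next
  case (scale c f)
  then show ?case by (simp add: stuffle_reg_scale pderiv_smult drop_one_scale drop_one_in_H1)
next
  case (stuffle f)
  have 1: "e_word [1] \<in> H1" by simp
  note H = stuffle(1) drop_one_in_H1[OF stuffle(1)] 1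
  have "pderiv (stuffle_reg (Defs.stuffle (e_word [1]) f)) =
      stuffle_reg f + [:0, 1:] * stuffle_reg (drop_one f)"
    unfolding stuffle_reg_stuffle[OF H(3,1)] stuffle_reg_1 pderiv_mult stuffle(2)
    by (simp add: pderiv_pCons)
  also have "\<dots> = stuffle_reg (drop_one (Defs.stuffle (e_word [1]) f))"
    unfolding drop_one_stuffle_1[OF H(1)]
    using H by (simp only: stuffle_reg_add stuffle_in_H1 stuffle_reg_stuffle stuffle_reg_1)
  finally show ?case .
qed

lemma pderiv_stuffle_reg_Cons:
  assumes "is_index (k # w)"
  shows "pderiv (stuffle_reg (e_word (k # w))) = (if k = 1 then stuffle_reg (e_word w) else 0)"
  using pderiv_stuffle_reg[of "e_word (k # w)"] assms
  by (simp add: drop_one_e_word stuffle_reg_0)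

section \<open>The ring of multiple zeta values\<close>

interpretation rat_module: module "\<lambda>(c::rat) (x::real). of_rat c * x"
  by unfold_locales (auto simp: algebra_simps of_rat_add of_rat_mult)

lemma mzv_space_add: "x \<in> mzv_space \<Longrightarrow> y \<in> mzv_space \<Longrightarrow> x + y \<in> mzv_space"
  unfolding mzv_space_def by (rule rat_module.span_add)

lemma mzv_space_0: "0 \<in> mzv_space"
  unfolding mzv_space_def by (rule rat_module.span_zero)

lemma mzv_space_scale: "x \<in> mzv_space \<Longrightarrow> of_rat c * x \<in> mzv_space"
  unfolding mzv_space_def by (rule rat_module.span_scale)

lemma mzv_in_mzv_space: "admissible ks \<Longrightarrow> mzv ks \<in> mzv_space"
  unfolding mzv_space_def by (rule rat_module.span_base) auto

lemma stuffle_reg_admissible_combination: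
  assumes "Poly_Mapping.keys f \<subseteq> Collect admissible"
  shows "f \<in> H1 \<and> (\<exists>x\<in>mzv_space. stuffle_reg f = [:x:])"
  using assms
proof (induction rule: word_poly_induct)
  case zero
  then show ?case using mzv_space_0 by (auto simp: stuffle_reg_0 intro!: bexI[of _ 0])
next
  case (word w)
  then show ?case using mzv_in_mzv_space[of w] stuffle_reg_admissible[of w] by (auto simp: admissible_def)
next
  case (add f g)
  then show ?case using mzv_space_add by (auto simp: stuffle_reg_add H1_add)
next
  case (scale c f)
  then show ?case using mzv_space_scale by (auto simp: stuffle_reg_scale H1_scale)
qed

text \<open>Compare the constant polynomials on both sides of
  \<open>stuffle_reg (stuffle u v) = stuffle_reg u * stuffle_reg v\<close>.\<close>
lemma mzv_mult:
  assumes "admissible u" "admissible v"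
  shows "mzv u * mzv v \<in> mzv_space"
proof -
  have "is_index u" "is_index v" using assms by (auto simp: admissible_def)
  then have "stuffle_reg (stuffle_words u v) = [:mzv u * mzv v:]"
    using stuffle_reg_stuffle[of "e_word u" "e_word v"] assms by (simp add: stuffle_reg_admissible)
  moreover obtain x where "x \<in> mzv_space" "stuffle_reg (stuffle_words u v) = [:x:]"
    using stuffle_reg_admissible_combination[OF keys_stuffle_words_admissible[OF assms]] by blast
  ultimately show ?thesis by simp
qed

lemma mzv_space_mult:
  assumes "x \<in> mzv_space" "y \<in> mzv_space"
  shows "x * y \<in> mzv_space"
proof -
  have 1: "mzv u * y \<in> mzv_space" if "admissible u" for u
    using assms(2) unfolding mzv_space_def
  proof (induction rule: rat_module.span_induct_alt)
    case base
    then show ?case by (simp add: rat_module.span_zero)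
  next
    case (step c z y)
    then obtain v where "admissible v" "z = mzv v" by blast
    then have "mzv u * z \<in> mzv_space" using that mzv_mult by blast
    then have "of_rat c * (mzv u * z) + mzv u * y \<in> mzv_space"
      using step unfolding mzv_space_def by (intro rat_module.span_add rat_module.span_scale)
    then show ?case by (simp add: mzv_space_def algebra_simps)
  qed
  from assms(1) show ?thesis unfolding mzv_space_def
  proof (induction rule: rat_module.span_induct_alt)
    case base
    then show ?case by (simp add: rat_module.span_zero)
  next
    case (step c z x)
    then obtain u where "admissible u" "z = mzv u" by blast
    then have "z * y \<in> mzv_space" using 1 by blast
    then have "of_rat c * (z * y) + x * y \<in> mzv_space"
      using step unfolding mzv_space_def by (intro rat_module.span_add rat_module.span_scale)
    then show ?case by (simp add: mzv_space_def algebra_simps)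
  qed
qed

definition mzv_poly :: "real poly \<Rightarrow> bool" where
  "mzv_poly p \<longleftrightarrow> (\<forall>i. coeff p i \<in> mzv_space)"

lemma mzv_space_sum: "(\<And>i. i \<in> A \<Longrightarrow> f i \<in> mzv_space) \<Longrightarrow> sum f A \<in> mzv_space"
  by (induction A rule: infinite_finite_induct) (auto intro: mzv_space_add mzv_space_0)

lemma mzv_poly_add: "mzv_poly p \<Longrightarrow> mzv_poly q \<Longrightarrow> mzv_poly (p + q)"
  by (simp add: mzv_poly_def mzv_space_add)

lemma mzv_poly_mult: "mzv_poly p \<Longrightarrow> mzv_poly q \<Longrightarrow> mzv_poly (p * q)"
  by (auto simp: mzv_poly_def coeff_mult intro!: mzv_space_sum mzv_space_mult)

lemma mzv_poly_scale: "mzv_poly p \<Longrightarrow> mzv_poly (smult (of_rat c) p)"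
  by (simp add: mzv_poly_def mzv_space_scale)

lemma mzv_poly_pCons: "mzv_poly (pCons a p) \<longleftrightarrow> a \<in> mzv_space \<and> mzv_poly p"
  by (auto simp: mzv_poly_def coeff_pCons split: nat.splits)

lemma mzv_poly_0: "mzv_poly 0"
  by (simp add: mzv_poly_def mzv_space_0)

lemma one_in_mzv_space: "1 \<in> mzv_space"
  using mzv_in_mzv_space[of "[]"] by (simp add: mzv_Nil admissible_def)

lemma mzv_poly_stuffle_reg: "f \<in> H1 \<Longrightarrow> mzv_poly (stuffle_reg f)"
proof (induction rule: H1_induct)
  case (admissible w)
  then show ?case by (simp add: stuffle_reg_admissible mzv_poly_pCons mzv_poly_0 mzv_in_mzv_space)
next
  case (stuffle f)
  have "mzv_poly [:0, 1:]" by (simp add: mzv_poly_pCons mzv_poly_0 mzv_space_0 one_in_mzv_space)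
  then show ?case using stuffle stuffle_reg_stuffle[of "e_word [1]" f]
    by (simp add: stuffle_reg_1[simplified] del: mult_pCons_left) (metis mzv_poly_mult)
qed (auto simp: stuffle_reg_add stuffle_reg_scale intro: mzv_poly_add mzv_poly_scale)

abbreviation cpoly :: "real poly \<Rightarrow> complex poly" where
  "cpoly \<equiv> map_poly of_real"

lemma cpoly_add: "cpoly (p + q) = cpoly p + cpoly q"
  by (rule poly_eqI) (simp add: coeff_map_poly)

lemma cpoly_mult: "cpoly (p * q) = cpoly p * cpoly q"
  by (rule poly_eqI) (simp add: coeff_map_poly coeff_mult)

lemma cpoly_smult: "cpoly (smult c p) = smult (of_real c) (cpoly p)"
  by (rule poly_eqI) (simp add: coeff_map_poly)

lemma cpoly_pderiv: "cpoly (pderiv p) = pderiv (cpoly p)"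
  by (rule poly_eqI) (simp add: coeff_map_poly coeff_pderiv)

lemma cpoly_pCons [simp]: "cpoly (pCons a p) = pCons (of_real a) (cpoly p)"
  by (rule poly_eqI) (auto simp: coeff_map_poly coeff_pCons split: nat.splits)

text \<open>The bridge from algebra to analysis: a sequence of functionals that is asymptotically
  multiplicative with respect to \<open>e\<^sub>1\<close>, and correct on admissible words, follows the regularization
  evaluated at its own value on \<open>e\<^sub>1\<close>. Only a logarithmic bound on that value enters, so the two
  halves of the sum at a root of unity can be treated alike before their difference is known.\<close>
lemma stuffle_reg_asymptotics:
  fixes A :: "nat \<Rightarrow> nat list \<Rightarrow> complex"
  assumes bounded: "log_bounded (\<lambda>n. A n [1])"
    and stuffle: "\<And>w. is_index w \<Longrightarrow>
        log_negligible (\<lambda>n. lin_eval (A n) (stuffle_words [1] w) - A n [1] * A n w)"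
    and admissible: "\<And>w. admissible w \<Longrightarrow> log_negligible (\<lambda>n. A n w - of_real (mzv w))"
    and "f \<in> H1"
  shows "log_negligible (\<lambda>n. lin_eval (A n) f - poly (cpoly (stuffle_reg f)) (A n [1]))"
  using assms(4)
proof (induction rule: H1_induct)
  case (admissible w)
  then show ?case using assms(3)[of w] by (simp add: stuffle_reg_admissible)
next
  case (add f g)
  then show ?case using log_negligible_add[OF add(3,4)]
    by (simp add: stuffle_reg_add lin_eval_add cpoly_add algebra_simps)
next
  case (scale c f)
  have "of_rat c = complex_of_real (of_rat c)" by (cases c) (simp add: of_rat_rat)
  then show ?case using scale log_negligible_cmult[OF scale(2), of "of_rat c"]
    by (simp add: stuffle_reg_scale lin_eval_scale cpoly_smult algebra_simps)
next
  case (stuffle f)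
  have keys: "Poly_Mapping.keys f \<subseteq> Collect is_index" using stuffle(1) by (simp add: H1_iff)
  have 1: "log_negligible (\<lambda>n. lin_eval (A n) (Defs.stuffle (e_word [1]) f) - A n [1] * lin_eval (A n) f)"
    using keys
  proof (induction rule: word_poly_induct)
    case zero
    show ?case by (simp add: stuffle_e_word)
  next
    case (word w)
    then show ?case using assms(2)[of w] by simp
  next
    case (add f g)
    from log_negligible_add[OF add] show ?case
      by (simp add: stuffle_add_right lin_eval_add algebra_simps)
  next
    case (scale c f)
    from log_negligible_cmult[OF scale, of "of_rat c"] show ?case
      by (simp add: stuffle_scale_right lin_eval_scale algebra_simps)
  qed
  have "log_negligible (\<lambda>n. A n [1] * (lin_eval (A n) f - poly (cpoly (stuffle_reg f)) (A n [1])))"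
    using log_negligible_mult[OF stuffle(2) bounded] by (simp add: mult.commute)
  from log_negligible_add[OF 1 this] show ?case
    using stuffle_reg_stuffle[of "e_word [1]" f] stuffle(1)
    by (simp add: cpoly_mult stuffle_reg_1[simplified] algebra_simps del: mult_pCons_left)
qed

section \<open>Sums over letters close to inverse powers\<close>

lemma harm_add_le: "harm (M + k) \<le> harm M + real k / (real M + 1)"
proof (induction k)
  case (Suc k)
  have "inverse (real (Suc (M + k))) \<le> 1 / (real M + 1)"
    by (simp add: inverse_eq_divide frac_le)
  then show ?case using Suc by (simp add: harm_Suc add_divide_distrib)
qed simp

lemma harm_half_le:
  assumes "1 \<le> M" "n \<le> 2 * M + 2"
  shows "harm n \<le> 3 * (harm M :: real)"
proof -
  have "harm n \<le> (harm (M + (M + 2)) :: real)" using assms by (intro harm_mono) simp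
  also have "\<dots> \<le> harm M + real (M + 2) / (real M + 1)" by (rule harm_add_le)
  also have "real (M + 2) / (real M + 1) \<le> 2" by (simp add: field_simps)
  finally show ?thesis using harm_ge_1[OF assms(1)] by linarith
qed

text \<open>Truncation near \<open>n/2\<close>, the range in which the letters at a root of unity stay comparable
  to \<open>1/m\<close>. The tolerance covers both ways of rounding.\<close>
definition half_cut :: "(nat \<Rightarrow> nat) \<Rightarrow> bool" where
  "half_cut M \<longleftrightarrow> (\<forall>n. 2 * M n \<le> n \<and> n \<le> 2 * M n + 2)"

lemma half_cut_at_top:
  assumes "half_cut M" shows "filterlim M at_top sequentially"
  unfolding filterlim_at_top
proof
  fix Z
  show "\<forall>\<^sub>F n in sequentially. Z \<le> M n"
    using eventually_ge_at_top[of "2 * Z + 2"]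
  proof eventually_elim
    case (elim n)
    then show ?case using assms[unfolded half_cut_def, rule_format, of n] by linarith
  qed
qed

lemma log_negligible_half_cut:
  assumes "log_negligible e" "half_cut M"
  shows "log_negligible (\<lambda>n. e (M n))"
  unfolding log_negligible_def
proof
  fix j
  have lim: "filterlim M at_top sequentially" by (rule half_cut_at_top[OF assms(2)])
  have "(\<lambda>n. harm n ^ j * norm (e n)) \<longlonglongrightarrow> 0" using assms(1) by (simp add: log_negligible_def)
  from filterlim_compose[OF this lim]
  have *: "(\<lambda>n. 3 ^ j * (harm (M n) ^ j * norm (e (M n)))) \<longlonglongrightarrow> 0"
    by (rule tendsto_mult_right_zero)
  have "\<forall>\<^sub>F n in sequentially. 1 \<le> M n" using lim by (simp add: filterlim_at_top)
  then have "\<forall>\<^sub>F n in sequentially. norm (harm n ^ j * norm (e (M n)))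
      \<le> 3 ^ j * (harm (M n) ^ j * norm (e (M n)))"
  proof eventually_elim
    case (elim n)
    have "harm n ^ j \<le> (3 * harm (M n) :: real) ^ j"
      using harm_half_le[OF elim, of n] assms(2) by (intro power_mono) (auto simp: half_cut_def harm_nonneg)
    then have "harm n ^ j * norm (e (M n)) \<le> (3 * harm (M n)) ^ j * norm (e (M n))"
      by (rule mult_right_mono) simp
    then show ?case by (simp add: abs_mult harm_nonneg power_mult_distrib mult.assoc)
  qed
  then show "(\<lambda>n. harm n ^ j * norm (e (M n))) \<longlonglongrightarrow> 0"
    by (rule Lim_null_comparison[OF _ *])
qed

text \<open>The deviation allowed at \<open>m\<close> is \<open>\<delta>m\<close> relative to the letter \<open>1/m\<^sup>k\<close>; with \<open>\<delta> = O(1/n)\<close> it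
  is small for small \<open>m\<close> and of constant size near the middle. This is why the comparison
  with the harmonic sums needs a leading letter at least 2.\<close>
locale near_harmonic = approx_letters t "\<lambda>m. 2 / real m" \<delta> "2 * harm N" N
  for t :: "nat \<Rightarrow> nat \<Rightarrow> complex" and \<delta> N +
  fixes c :: "nat \<Rightarrow> real"
  assumes near: "\<And>k m. 1 \<le> k \<Longrightarrow> 0 < m \<Longrightarrow> m \<le> N \<Longrightarrow>
      norm (t k m - of_real (inv_letter k m)) \<le> c k * \<delta> * (real m * inv_letter k m)"
    and c_nonneg: "0 \<le> c k"
begin

text \<open>The extra \<open>1\<close> only serves to make the powers of \<open>g\<close> increasing for every \<open>N\<close>.\<close>

abbreviation g :: real where "g \<equiv> 2 * (1 + harm N)"

lemma g_ge_1: "1 \<le> g"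
  using harm_nonneg[of N, where 'a=real] by simp

lemma letter_step:
  assumes "is_index (k # w)" "0 < m" "m \<le> N" "0 \<le> C"
    and "norm (msum t 0 (m - 1) w - of_real (hsum (m - 1) w)) \<le> C * \<delta> * real (m - 1) * g ^ length w"
  shows "norm (t k m * msum t 0 (m - 1) w - of_real (inv_letter k m * hsum (m - 1) w))
    \<le> (c k + C) * \<delta> * g ^ length w * (real m * inv_letter k m)"
proof -
  let ?S = "msum t 0 (m - 1) w" and ?H = "complex_of_real (hsum (m - 1) w)"
    and ?i = "complex_of_real (inv_letter k m)"
  have i0: "0 \<le> inv_letter k m" by (simp add: inv_letter_def)
  have S: "norm ?S \<le> g ^ length w"
  proof -
    have "norm ?S \<le> (2 * harm N) ^ length w" using assms by (intro norm_msum_le) auto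
    also have "\<dots> \<le> g ^ length w" by (intro power_mono) (auto simp: harm_nonneg)
    finally show ?thesis .
  qed
  have "norm ((t k m - ?i) * ?S) \<le> c k * \<delta> * (real m * inv_letter k m) * g ^ length w"
    unfolding norm_mult using assms S near[of k m] i0 c_nonneg delta_nonneg
    by (intro mult_mono) auto
  moreover have "norm (?i * (?S - ?H)) \<le> inv_letter k m * (C * \<delta> * real m * g ^ length w)"
  proof -
    have "C * \<delta> * real (m - 1) * g ^ length w \<le> C * \<delta> * real m * g ^ length w"
      using assms(4) delta_nonneg g_ge_1 by (intro mult_right_mono mult_left_mono) auto
    then have "norm (?S - ?H) \<le> C * \<delta> * real m * g ^ length w" using assms(5) by linarith
    then show ?thesis unfolding norm_mult using i0 by (intro mult_mono) auto
  qed
  ultimately have "norm ((t k m - ?i) * ?S + ?i * (?S - ?H)) \<le>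
      c k * \<delta> * (real m * inv_letter k m) * g ^ length w + inv_letter k m * (C * \<delta> * real m * g ^ length w)"
    by (intro norm_triangle_mono)
  then show ?thesis by (simp add: algebra_simps)
qed

lemma msum_near_hsum:
  assumes "is_index w" "n \<le> N"
  shows "norm (msum t 0 n w - of_real (hsum n w)) \<le> sum_list (map c w) * \<delta> * real n * g ^ length w"
  using assms
proof (induction w arbitrary: n)
  case Nil
  show ?case by simp
next
  case (Cons k w)
  let ?C = "sum_list (map c w)"
  have C: "0 \<le> ?C" by (rule sum_list_nonneg) (auto simp: c_nonneg)
  have g: "g ^ length w \<le> g ^ length (k # w)" using g_ge_1 by (intro power_increasing) auto
  have "norm (t k m * msum t 0 (m - 1) w - of_real (inv_letter k m * hsum (m - 1) w))
      \<le> (c k + ?C) * \<delta> * g ^ length (k # w)" if m: "m \<in> {0<..n}" for m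
  proof -
    have "norm (t k m * msum t 0 (m - 1) w - of_real (inv_letter k m * hsum (m - 1) w))
        \<le> (c k + ?C) * \<delta> * g ^ length w * (real m * inv_letter k m)"
      using m Cons C by (intro letter_step Cons.IH) auto
    also have "\<dots> \<le> (c k + ?C) * \<delta> * g ^ length (k # w) * 1"
    proof (intro mult_mono g)
      have "real m ^ 1 \<le> real m ^ k" using m Cons.prems by (intro power_increasing) auto
      then show "real m * inv_letter k m \<le> 1" using m by (simp add: inv_letter_def field_simps)
    qed (use C c_nonneg[of k] delta_nonneg g_ge_1 in \<open>auto simp: inv_letter_def\<close>)
    finally show ?thesis by simp
  qed
  then have "norm (\<Sum>m\<in>{0<..n}. t k m * msum t 0 (m - 1) w - of_real (inv_letter k m * hsum (m - 1) w))
      \<le> (\<Sum>m\<in>{0<..n}. (c k + ?C) * \<delta> * g ^ length (k # w))"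
    by (rule sum_norm_le)
  then show ?case by (simp add: sum_subtractf algebra_simps)
qed

text \<open>A leading letter at least 2 gains one factor \<open>1/m\<close>, which replaces the factor \<open>N\<close> in
  \<open>msum_near_hsum\<close> by a logarithm.\<close>
lemma msum_near_hsum_admissible:
  assumes "admissible w"
  shows "norm (msum t 0 N w - of_real (hsum N w)) \<le> sum_list (map c w) * \<delta> * g ^ length w"
proof (cases w)
  case (Cons k w')
  then have k: "2 \<le> k" "is_index (k # w')" using assms by (auto simp: admissible_def)
  let ?C = "sum_list (map c w')"
  have C: "0 \<le> ?C" by (rule sum_list_nonneg) (auto simp: c_nonneg)
  have "norm (t k m * msum t 0 (m - 1) w' - of_real (inv_letter k m * hsum (m - 1) w'))
      \<le> (c k + ?C) * \<delta> * g ^ length w' * (1 / real m)" if m: "m \<in> {0<..N}" for m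
  proof -
    have "norm (t k m * msum t 0 (m - 1) w' - of_real (inv_letter k m * hsum (m - 1) w'))
        \<le> (c k + ?C) * \<delta> * g ^ length w' * (real m * inv_letter k m)"
      using m k C by (intro letter_step msum_near_hsum) auto
    also have "\<dots> \<le> (c k + ?C) * \<delta> * g ^ length w' * (1 / real m)"
    proof (intro mult_left_mono)
      have "real m ^ 2 \<le> real m ^ k" using m k by (intro power_increasing) auto
      then show "real m * inv_letter k m \<le> 1 / real m"
        using m by (simp add: inv_letter_def field_simps power2_eq_square)
    qed (use C c_nonneg[of k] delta_nonneg g_ge_1 in auto)
    finally show ?thesis by simp
  qed
  then have "norm (\<Sum>m\<in>{0<..N}. t k m * msum t 0 (m - 1) w' - of_real (inv_letter k m * hsum (m - 1) w'))
      \<le> (\<Sum>m\<in>{0<..N}. (c k + ?C) * \<delta> * g ^ length w' * (1 / real m))"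
    by (rule sum_norm_le)
  also have "\<dots> = (c k + ?C) * \<delta> * g ^ length w' * harm N"
    by (simp only: sum_distrib_left[symmetric] harm_eq_sum)
  also have "\<dots> \<le> (c k + ?C) * \<delta> * g ^ length w' * g"
    using C c_nonneg[of k] delta_nonneg g_ge_1 harm_nonneg[of N, where 'a=real] by (intro mult_left_mono) auto
  finally show ?thesis unfolding Cons by (simp add: sum_subtractf algebra_simps)
qed simp

end

text \<open>The three hypotheses of \<open>stuffle_reg_asymptotics\<close> follow from the bound on multiple sums,
  the approximate stuffle product with \<open>e\<^sub>1\<close>, and the comparison with the harmonic sums.\<close>
lemma near_harmonic_asymptotics:
  fixes t :: "nat \<Rightarrow> nat \<Rightarrow> nat \<Rightarrow> complex"
  assumes near: "\<forall>\<^sub>F n in sequentially. near_harmonic (t n) (\<delta> n) (M n) c"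
    and "half_cut M" and \<delta>: "log_negligible \<delta>" and "is_index w"
  shows "log_negligible (\<lambda>n. msum (t n) 0 (M n) w - poly (cpoly (stuffle_reg (e_word w))) (msum (t n) 0 (M n) [1]))"
    and "log_bounded (\<lambda>n. msum (t n) 0 (M n) [1])"
proof -
  have harm_le: "harm (M n) \<le> (harm n :: real)" for n
    using assms(2)[unfolded half_cut_def, rule_format, of n] by (intro harm_mono) simp
  have bd: "log_bounded (\<lambda>n. (a * (1 + b * harm n)) ^ i :: real)" for a b i
    using log_bounded_poly[OF log_bounded_harm, of "[:a, a * b:] ^ i"]
    by (simp add: poly_power algebra_simps)
  show b1: "log_bounded (\<lambda>n. msum (t n) 0 (M n) [1])"
    unfolding log_bounded_def
  proof (intro exI)
    show "\<forall>\<^sub>F n in sequentially. norm (msum (t n) 0 (M n) [1]) \<le> 2 * harm n ^ 1"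
      using near
    proof eventually_elim
      case (elim n)
      interpret near_harmonic "t n" "\<delta> n" "M n" c by (rule elim)
      show ?case using norm_msum_le[of "[1]" "M n"] harm_le[of n] by simp
    qed
  qed
  have "log_negligible (\<lambda>n. lin_eval (msum (t n) 0 (M n)) (e_word w)
      - poly (cpoly (stuffle_reg (e_word w))) (msum (t n) 0 (M n) [1]))"
  proof (rule stuffle_reg_asymptotics[where A="\<lambda>n. msum (t n) 0 (M n)", OF b1])
    fix v assume v: "is_index v"
    let ?i = "1 + length v"
    have "log_negligible (\<lambda>n. \<delta> n * (4 * (1 + 2 * harm n)) ^ ?i)"
      by (intro log_negligible_mult \<delta> bd)
    moreover have "\<forall>\<^sub>F n in sequentially. norm (lin_eval (msum (t n) 0 (M n)) (stuffle_words [1] v)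
        - msum (t n) 0 (M n) [1] * msum (t n) 0 (M n) v) \<le> norm (\<delta> n * (4 * (1 + 2 * harm n)) ^ ?i)"
      using near
    proof eventually_elim
      case (elim n)
      interpret near_harmonic "t n" "\<delta> n" "M n" c by (rule elim)
      have "norm (lin_eval (msum (t n) 0 (M n)) (stuffle_words [1] v)
        - msum (t n) 0 (M n) [1] * msum (t n) 0 (M n) v) \<le> \<delta> n * (4 * (1 + 2 * harm (M n))) ^ ?i"
        using msum_stuffle_approx[of "[1]" v "M n"] v by (subst norm_minus_commute) simp
      also have "\<dots> \<le> \<delta> n * (4 * (1 + 2 * harm n)) ^ ?i"
        using delta_nonneg harm_le[of n] by (intro mult_left_mono power_mono) (auto simp: harm_nonneg)
      also have "\<dots> = norm (\<delta> n * (4 * (1 + 2 * harm n)) ^ ?i)"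
        using delta_nonneg by (simp add: abs_mult harm_nonneg)
      finally show ?case .
    qed
    ultimately show "log_negligible (\<lambda>n. lin_eval (msum (t n) 0 (M n)) (stuffle_words [1] v)
        - msum (t n) 0 (M n) [1] * msum (t n) 0 (M n) v)"
      by (rule log_negligible_bound)
  next
    fix v assume v: "admissible v"
    let ?i = "length v" and ?C = "sum_list (map c v)"
    have "log_negligible (\<lambda>n. ?C * (\<delta> n * (2 * (1 + 1 * harm n)) ^ ?i))"
      by (intro log_negligible_cmult log_negligible_mult \<delta> bd)
    moreover have "\<forall>\<^sub>F n in sequentially. norm (msum (t n) 0 (M n) v - of_real (hsum (M n) v))
       \<le> norm (?C * (\<delta> n * (2 * (1 + 1 * harm n)) ^ ?i))"
      using near
    proof eventually_elim
      case (elim n)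
      interpret near_harmonic "t n" "\<delta> n" "M n" c by (rule elim)
      have C: "0 \<le> ?C" by (rule sum_list_nonneg) (auto simp: c_nonneg)
      have "norm (msum (t n) 0 (M n) v - of_real (hsum (M n) v)) \<le> ?C * (\<delta> n * (2 * (1 + harm (M n))) ^ ?i)"
        using msum_near_hsum_admissible[OF v] by (simp add: mult.assoc)
      also have "\<dots> \<le> ?C * (\<delta> n * (2 * (1 + 1 * harm n)) ^ ?i)"
        using delta_nonneg harm_le[of n] C by (intro mult_left_mono power_mono) (auto simp: harm_nonneg)
      also have "\<dots> = norm (?C * (\<delta> n * (2 * (1 + 1 * harm n)) ^ ?i))"
        using delta_nonneg C by (simp add: abs_mult harm_nonneg)
      finally show ?case .
    qed
    ultimately have "log_negligible (\<lambda>n. msum (t n) 0 (M n) v - of_real (hsum (M n) v))"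
      by (rule log_negligible_bound)
    moreover have "log_negligible (\<lambda>n. complex_of_real (hsum (M n) v - mzv v))"
      unfolding log_negligible_of_real by (rule log_negligible_half_cut[OF hsum_mzv[OF v] assms(2)])
    ultimately show "log_negligible (\<lambda>n. msum (t n) 0 (M n) v - of_real (mzv v))"
      using log_negligible_add by fastforce
  qed (use assms(4) in simp)
  then show "log_negligible (\<lambda>n. msum (t n) 0 (M n) w
      - poly (cpoly (stuffle_reg (e_word w))) (msum (t n) 0 (M n) [1]))" by simp
qed

section \<open>The letters at a root of unity\<close>

lemma sin_ge_linear:
  fixes x :: real
  assumes "0 \<le> x" "x \<le> pi / 2"
  shows "2 * x / pi \<le> sin x"
proof -
  have "concave_on {0..pi / 2} (sin :: real \<Rightarrow> real)"
  proof (rule f''_le0_imp_concave)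
    fix y :: real assume "y \<in> {0..pi / 2}"
    then show "- sin y \<le> 0" using sin_ge_zero[of y] by auto
  qed (auto intro!: derivative_eq_intros)
  from concave_onD_Icc'[OF this, of x] show ?thesis using assms by simp
qed

definition q_letter :: "nat \<Rightarrow> nat \<Rightarrow> nat \<Rightarrow> complex" where
  "q_letter n k m = unit_root n ^ ((k - 1) * m) / q_int (unit_root n) m ^ k"

text \<open>Up to the sign \<open>(-1)\<^sup>k\<close>, the letter at the reflected point \<open>n - m\<close> (\<open>q_letter_reflect\<close>). Up to a
  power of \<open>q\<close> it is also the complex conjugate of \<open>q_letter\<close>.\<close>
definition q_letter_conj :: "nat \<Rightarrow> nat \<Rightarrow> nat \<Rightarrow> complex" where
  "q_letter_conj n k m = unit_root n ^ m / q_int (unit_root n) m ^ k"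

lemma norm_1_minus_unit_root_power: "norm (1 - unit_root n ^ m) = 2 * \<bar>sin (pi * real m / real n)\<bar>"
proof -
  have "unit_root n ^ m = exp (\<i> * of_real (2 * pi * real m / real n))"
    unfolding unit_root_def exp_of_nat_mult[symmetric] by (simp add: algebra_simps)
  then show ?thesis
    using dist_exp_i_1[of "2 * pi * real m / real n"] by (simp add: norm_minus_commute)
qed

locale cyclotomic =
  fixes n :: nat
  assumes n: "2 \<le> n"
begin

abbreviation "q \<equiv> unit_root n"
definition "\<delta> = norm (1 - q)"

text \<open>The letters of the entry 1 at the two ends of the range. Those of larger entries are products of
  the two (\<open>q_letter_eq\<close>, \<open>q_letter_conj_eq\<close>).\<close>

definition x :: "nat \<Rightarrow> complex" where "x m = 1 / q_int q m"
definition y :: "nat \<Rightarrow> complex" where "y m = q ^ m / q_int q m"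

lemma norm_q [simp]: "norm q = 1"
proof -
  have "q = exp (\<i> * of_real (2 * pi / real n))" by (simp add: unit_root_def mult_ac)
  then show ?thesis by (simp only: norm_exp_i_times)
qed

lemma q_power_n: "q ^ n = 1"
  using n by (simp add: unit_root_def exp_of_nat_mult[symmetric])

lemma q_nonzero: "q \<noteq> 0"
  using norm_q by (metis norm_zero zero_neq_one)

lemma delta_le: "\<delta> \<le> 2 * pi / real n"
  using norm_1_minus_unit_root_power[of n 1] abs_sin_x_le_abs_x[of "pi / real n"] by (simp add: \<delta>_def)

lemma delta_pos: "0 < \<delta>"
proof -
  have "0 < sin (pi / real n)" using n by (intro sin_gt_zero) (auto simp: field_simps)
  then show ?thesis using norm_1_minus_unit_root_power[of n 1] by (simp add: \<delta>_def)
qed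

lemma q_neq_1: "q \<noteq> 1"
  using delta_pos by (auto simp: \<delta>_def)

lemma norm_q_int: "norm (q_int q m) = norm (1 - q ^ m) / \<delta>"
  by (simp add: q_int_def norm_divide \<delta>_def)

lemma norm_q_int_ge:
  assumes "0 < m" "2 * m \<le> n"
  shows "2 * real m / pi \<le> norm (q_int q m)"
proof -
  have "2 * (pi * real m / real n) / pi \<le> sin (pi * real m / real n)"
    by (rule sin_ge_linear) (use assms n in \<open>auto simp: field_simps\<close>)
  then have "4 * real m / real n \<le> norm (1 - q ^ m)"
    using n by (simp add: norm_1_minus_unit_root_power)
  then have "4 * real m / real n / (2 * pi / real n) \<le> norm (q_int q m)"
    unfolding norm_q_int using delta_le delta_pos by (intro frac_le) auto
  then show ?thesis using n by (simp add: field_simps)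
qed

lemma q_int_reflect:
  assumes "m < n" shows "q_int q (n - m) = - (q_int q m / q ^ m)" and "q ^ (n - m) = 1 / q ^ m"
proof -
  have "q ^ (n - m) * q ^ m = 1" using assms q_power_n by (simp add: power_add[symmetric])
  then show "q ^ (n - m) = 1 / q ^ m" using q_nonzero by (simp add: field_simps)
  then show "q_int q (n - m) = - (q_int q m / q ^ m)"
    using q_nonzero q_neq_1 by (simp add: q_int_def field_simps)
qed

lemma q_int_1: "q_int q 1 = 1"
  using q_neq_1 by (simp add: q_int_def)

lemma norm_q_int_ge_1:
  assumes "0 < m" "m < n"
  shows "1 \<le> norm (q_int q m)"
proof -
  have half: "1 \<le> norm (q_int q j)" if "0 < j" "2 * j \<le> n" for j
  proof (cases "j = 1")
    case False
    then have "2 \<le> j" using that by simp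
    then have "2 * 2 / pi \<le> 2 * real j / pi" by (intro divide_right_mono) auto
    moreover have "1 \<le> 2 * 2 / pi" using pi_less_4 by simp
    ultimately show ?thesis using norm_q_int_ge[OF that] by linarith
  qed (simp add: q_int_1[simplified])
  show ?thesis
  proof (cases "2 * m \<le> n")
    case False
    then have "1 \<le> norm (q_int q (n - m))" using assms by (intro half) auto
    then show ?thesis using q_int_reflect(1)[OF assms(2)] by (simp add: norm_divide norm_power)
  qed (use half assms in auto)
qed

lemma q_int_nonzero: "0 < m \<Longrightarrow> m < n \<Longrightarrow> q_int q m \<noteq> 0"
  using norm_q_int_ge_1[of m] by auto

lemma norm_y [simp]: "norm (y m) = norm (x m)"
  by (simp add: x_def y_def norm_divide norm_power)

lemma norm_x_le_1: "0 < m \<Longrightarrow> m < n \<Longrightarrow> norm (x m) \<le> 1"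
  using norm_q_int_ge_1[of m] by (simp add: x_def norm_divide divide_le_eq_1)

lemma norm_x_le:
  assumes "0 < m" "2 * m \<le> n"
  shows "norm (x m) \<le> 2 / real m"
proof -
  have "norm (x m) \<le> 1 / (2 * real m / pi)"
    unfolding x_def norm_divide using norm_q_int_ge[OF assms] assms by (simp add: frac_le del: divide_divide_eq_right)
  also have "\<dots> \<le> 2 / real m" using assms pi_less_4 by (simp add: field_simps)
  finally show ?thesis .
qed

lemma x_minus_y: "0 < m \<Longrightarrow> m < n \<Longrightarrow> x m - y m = 1 - q"
proof -
  assume "0 < m" "m < n"
  then have "q_int q m \<noteq> 0" by (rule q_int_nonzero)
  then show ?thesis using q_neq_1
    by (simp add: x_def y_def diff_divide_distrib[symmetric]) (simp add: q_int_def field_simps)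
qed

lemma norm_q_power_minus_1: "norm (q ^ m - 1) \<le> real m * \<delta>"
  using norm_power_diff[of q 1 m] by (simp add: \<delta>_def norm_minus_commute)

lemma x_near:
  assumes "0 < m" "2 * m \<le> n"
  shows "norm (x m - 1 / of_nat m) \<le> 2 * \<delta>"
proof -
  have nz: "q_int q m \<noteq> 0" using assms n by (intro q_int_nonzero) auto
  have "q_int q m = (\<Sum>j<m. q ^ j)" unfolding q_int_def one_diff_power_eq using q_neq_1 by simp
  then have "norm (of_nat m - q_int q m) = norm (\<Sum>j<m. 1 - q ^ j)" by (simp add: sum_subtractf)
  also have "\<dots> \<le> (\<Sum>j<m. real m * \<delta>)"
  proof (rule sum_norm_le)
    fix j assume "j \<in> {..<m}"
    then have "real j * \<delta> \<le> real m * \<delta>" using delta_pos by (intro mult_right_mono) auto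
    then show "norm (1 - q ^ j) \<le> real m * \<delta>"
      using norm_q_power_minus_1[of j] by (simp add: norm_minus_commute)
  qed
  finally have d: "norm (of_nat m - q_int q m) \<le> real m * (real m * \<delta>)" by simp
  have "x m - 1 / of_nat m = (of_nat m - q_int q m) * x m / of_nat m"
    using nz assms by (simp add: x_def field_simps)
  then have "norm (x m - 1 / of_nat m) = norm (of_nat m - q_int q m) * norm (x m) / real m"
    by (simp add: norm_mult norm_divide)
  also have "\<dots> \<le> (real m * (real m * \<delta>)) * (2 / real m) / real m"
    using d norm_x_le[OF assms] delta_pos by (intro divide_right_mono mult_mono) auto
  also have "\<dots> = 2 * \<delta>" using assms by simp
  finally show ?thesis .
qed

lemma y_near:
  assumes "0 < m" "2 * m \<le> n"
  shows "norm (y m - 1 / of_nat m) \<le> 4 * \<delta>"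
proof -
  have "y m - 1 / of_nat m = (q ^ m - 1) * x m + (x m - 1 / of_nat m)"
    by (simp add: x_def y_def algebra_simps diff_divide_distrib)
  also have "norm \<dots> \<le> real m * \<delta> * (2 / real m) + 2 * \<delta>"
  proof (rule norm_triangle_mono[OF _ x_near[OF assms]])
    show "norm ((q ^ m - 1) * x m) \<le> real m * \<delta> * (2 / real m)"
      unfolding norm_mult using norm_q_power_minus_1[of m] norm_x_le[OF assms] delta_pos
      by (intro mult_mono) auto
  qed
  also have "\<dots> = 4 * \<delta>" using assms by simp
  finally show ?thesis .
qed

lemma q_letter_eq: "1 \<le> k \<Longrightarrow> q_letter n k m = x m * y m ^ (k - 1)"
  by (cases k) (simp_all add: q_letter_def x_def y_def power_divide mult.commute flip: power_mult)

lemma q_letter_conj_eq: "1 \<le> k \<Longrightarrow> q_letter_conj n k m = y m * x m ^ (k - 1)"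
  by (cases k) (simp_all add: q_letter_conj_def x_def y_def power_divide)

text \<open>Reflection exchanges \<open>1/[m]\<close> and \<open>q\<^sup>m/[m]\<close> up to sign, since \<open>[n - m] = -[m]/q\<^sup>m\<close>.\<close>
lemma q_letter_reflect:
  assumes "1 \<le> k" "0 < m" "m < n"
  shows "q_letter n k (n - m) = (-1) ^ k * q_letter_conj n k m"
proof -
  obtain l where k: "k = Suc l" using assms(1) by (cases k) auto
  have "x (n - m) = - y m" "y (n - m) = - x m"
    unfolding x_def y_def q_int_reflect[OF assms(3)] using q_nonzero by auto
  then show ?thesis using assms(1)
    by (simp add: q_letter_eq q_letter_conj_eq k power_minus[of "x m"])
qed

text \<open>Both families have the form \<open>u v\<^bsup>k-1\<^esup>\<close> with \<open>u - v\<close> of norm \<open>\<delta>\<close>, and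
  \<open>u v\<^bsup>k-1\<^esup> u v\<^bsup>l-1\<^esup> - u v\<^bsup>k+l-1\<^esup> = u v\<^bsup>k+l-2\<^esup> (u - v)\<close>.\<close>
lemma geometric_letter_mult:
  fixes u v :: complex
  assumes "norm u \<le> b" "norm v \<le> 1" "norm (u - v) \<le> \<delta>" "1 \<le> k" "1 \<le> l"
  shows "norm ((u * v ^ (k - 1)) * (u * v ^ (l - 1)) - u * v ^ (k + l - 1)) \<le> \<delta> * b"
proof -
  obtain k' l' where kl: "k = Suc k'" "l = Suc l'" using assms(4,5) by (cases k; cases l) auto
  have "(u * v ^ (k - 1)) * (u * v ^ (l - 1)) - u * v ^ (k + l - 1) = u * v ^ (k' + l') * (u - v)"
    unfolding kl by (simp add: power_add algebra_simps)
  also have "norm \<dots> = norm u * norm v ^ (k' + l') * norm (u - v)"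
    by (simp add: norm_mult norm_power)
  also have "\<dots> \<le> b * 1 * \<delta>"
    using assms order_trans[OF norm_ge_zero assms(1)] by (intro mult_mono power_le_one) auto
  finally show ?thesis by (simp add: mult.commute)
qed

lemma geometric_letter_le:
  fixes u v :: complex
  assumes "norm u \<le> b" "norm v \<le> 1"
  shows "norm (u * v ^ j) \<le> b"
proof -
  have "norm u * norm v ^ j \<le> b * 1"
    using assms order_trans[OF norm_ge_zero assms(1)] by (intro mult_mono power_le_one) auto
  then show ?thesis by (simp add: norm_mult norm_power)
qed

lemma geometric_letter_near:
  fixes u v :: complex
  assumes "norm (u - 1 / of_nat m) \<le> 4 * \<delta>" "norm (v - 1 / of_nat m) \<le> 4 * \<delta>"
    and "norm v \<le> 2 / real m" "0 < m"
  shows "norm (u * v ^ j - 1 / of_nat m ^ (j + 1)) \<le> 4 ^ (j + 1) * \<delta> / real m ^ j"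
proof (induction j)
  case (Suc j)
  have "u * v ^ Suc j - 1 / of_nat m ^ (Suc j + 1) =
      (u * v ^ j - 1 / of_nat m ^ (j + 1)) * v + 1 / of_nat m ^ (j + 1) * (v - 1 / of_nat m)"
    using assms(4) by (simp add: field_simps)
  also have "norm \<dots> \<le> 4 ^ (j + 1) * \<delta> / real m ^ j * (2 / real m) + 1 / real m ^ (j + 1) * (4 * \<delta>)"
  proof (rule norm_triangle_mono)
    show "norm ((u * v ^ j - 1 / of_nat m ^ (j + 1)) * v) \<le> 4 ^ (j + 1) * \<delta> / real m ^ j * (2 / real m)"
      unfolding norm_mult using Suc assms(3) delta_pos by (intro mult_mono) auto
    show "norm (1 / of_nat m ^ (j + 1) * (v - 1 / of_nat m)) \<le> 1 / real m ^ (j + 1) * (4 * \<delta>)"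
      unfolding norm_mult using assms(2) by (intro mult_mono) (auto simp: norm_divide norm_mult norm_power)
  qed
  also have "\<dots> = (2 * 4 ^ (j + 1) + 4) * \<delta> / real m ^ Suc j"
    by (simp add: algebra_simps add_divide_distrib)
  also have "\<dots> \<le> 4 ^ (Suc j + 1) * \<delta> / real m ^ Suc j"
  proof (intro divide_right_mono mult_right_mono)
    have "2 * (4 * a) + 4 \<le> 4 * (4 * a)" if "1 \<le> a" for a :: real using that by simp
    from this[of "4 ^ j"] show "2 * 4 ^ (j + 1) + 4 \<le> (4 ^ (Suc j + 1) :: real)" by simp
  qed (use delta_pos in auto)
  finally show ?case .
qed (use assms in simp)

lemma near_harmonic_geometric:
  fixes u v :: "nat \<Rightarrow> complex"
  assumes M: "2 * M \<le> n"
    and uv: "\<And>m. 0 < m \<Longrightarrow> m \<le> M \<Longrightarrow> (u m = x m \<and> v m = y m) \<or> (u m = y m \<and> v m = x m)"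
    and t: "\<And>k m. 1 \<le> k \<Longrightarrow> t k m = u m * v m ^ (k - 1)"
  shows "near_harmonic t \<delta> M (\<lambda>k. 4 ^ k)"
proof
  have *: "norm (u m) \<le> 2 / real m" "norm (v m) \<le> 1" "norm (u m - v m) \<le> \<delta>" "norm (v m) \<le> 2 / real m"
    "norm (u m - 1 / of_nat m) \<le> 4 * \<delta>" "norm (v m - 1 / of_nat m) \<le> 4 * \<delta>"
    if "0 < m" "m \<le> M" for m
  proof -
    have m: "0 < m" "2 * m \<le> n" "m < n" using that M n by auto
    have "norm (x m - y m) \<le> \<delta>" "norm (y m - x m) \<le> \<delta>"
      unfolding norm_minus_commute[of "y m"] x_minus_y[OF m(1,3)] \<delta>_def by simp_all
    moreover have "norm (x m - 1 / of_nat m) \<le> 4 * \<delta>"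
      using x_near[OF m(1,2)] delta_pos by simp
    ultimately show "norm (u m) \<le> 2 / real m" "norm (v m) \<le> 1" "norm (u m - v m) \<le> \<delta>"
      "norm (v m) \<le> 2 / real m" "norm (u m - 1 / of_nat m) \<le> 4 * \<delta>" "norm (v m - 1 / of_nat m) \<le> 4 * \<delta>"
      using uv[OF that] norm_x_le[OF m(1,2)] norm_x_le_1[OF m(1,3)] y_near[OF m(1,2)] by auto
  qed
  {
    fix k m :: nat assume km: "1 \<le> k" "0 < m" "m \<le> M"
    show "norm (t k m) \<le> 2 / real m"
      unfolding t[OF km(1)] by (intro geometric_letter_le *) (use km in auto)
    obtain j where k: "k = Suc j" using km by (cases k) auto
    have "norm (u m * v m ^ j - 1 / of_nat m ^ (j + 1)) \<le> 4 ^ (j + 1) * \<delta> / real m ^ j"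
      by (intro geometric_letter_near *) (use km in auto)
    then show "norm (t k m - of_real (inv_letter k m)) \<le> 4 ^ k * \<delta> * (real m * inv_letter k m)"
      using km by (simp add: t k inv_letter_def)
  next
    fix k l m :: nat assume km: "1 \<le> k" "1 \<le> l" "0 < m" "m \<le> M"
    then have "1 \<le> k + l" by simp
    show "norm (t k m * t l m - t (k + l) m) \<le> \<delta> * (2 / real m)"
      unfolding t[OF km(1)] t[OF km(2)] t[OF \<open>1 \<le> k + l\<close>]
      by (intro geometric_letter_mult *) (use km in auto)
  }
qed (use delta_pos in \<open>auto simp: harm_eq_sum sum_distrib_left\<close>)

lemma near_harmonic_q_letter: "2 * M \<le> n \<Longrightarrow> near_harmonic (q_letter n) \<delta> M (\<lambda>k. 4 ^ k)"
  by (rule near_harmonic_geometric[where u=x and v=y]) (auto simp: q_letter_eq)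

lemma near_harmonic_q_letter_conj: "2 * M \<le> n \<Longrightarrow> near_harmonic (q_letter_conj n) \<delta> M (\<lambda>k. 4 ^ k)"
  by (rule near_harmonic_geometric[where u=y and v=x]) (auto simp: q_letter_conj_eq)

text \<open>On the whole range the weight has to see both ends, as \<open>[m]\<close> and \<open>[n - m]\<close> have the same
  norm.\<close>
lemma approx_letters_q_letter:
  "approx_letters (q_letter n) (\<lambda>m. 2 / real m + 2 / real (n - m)) \<delta> (4 * harm n) (n - 1)"
proof
  let ?b = "\<lambda>m. 2 / real m + 2 / real (n - m)"
  have *: "norm (x m) \<le> ?b m" "norm (y m) \<le> 1" "norm (x m - y m) \<le> \<delta>" if "0 < m" "m \<le> n - 1" for m
  proof -
    have m: "0 < m" "m < n" using that n by auto
    show "norm (y m) \<le> 1" "norm (x m - y m) \<le> \<delta>"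
      using norm_x_le_1[OF m] x_minus_y[OF m] by (auto simp: \<delta>_def)
    show "norm (x m) \<le> ?b m"
    proof (cases "2 * m \<le> n")
      case True
      then show ?thesis using norm_x_le[OF m(1)] by (auto intro: order_trans)
    next
      case False
      have "norm (x m) = norm (x (n - m))"
        unfolding x_def q_int_reflect[OF m(2)] by (simp add: norm_divide norm_power)
      also have "\<dots> \<le> 2 / real (n - m)" using False m by (intro norm_x_le) auto
      finally show ?thesis by (auto intro: order_trans)
    qed
  qed
  {
    fix k m :: nat assume km: "1 \<le> k" "0 < m" "m \<le> n - 1"
    show "norm (q_letter n k m) \<le> ?b m"
      unfolding q_letter_eq[OF km(1)] by (intro geometric_letter_le *) (use km in auto)
  next
    fix k l m :: nat assume km: "1 \<le> k" "1 \<le> l" "0 < m" "m \<le> n - 1"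
    then have "1 \<le> k + l" by simp
    show "norm (q_letter n k m * q_letter n l m - q_letter n (k + l) m) \<le> \<delta> * ?b m"
      unfolding q_letter_eq[OF km(1)] q_letter_eq[OF km(2)] q_letter_eq[OF \<open>1 \<le> k + l\<close>]
      by (intro geometric_letter_mult *) (use km in auto)
  }
  have "(\<Sum>m\<in>{0<..n - 1}. 1 / real (n - m)) = (\<Sum>m\<in>{0<..n - 1}. 1 / real m)"
    by (rule sum.reindex_bij_witness[of _ "\<lambda>m. n - m" "\<lambda>m. n - m"]) (use n in auto)
  moreover have "?b m = 2 * (1 / real m) + 2 * (1 / real (n - m))" for m by simp
  ultimately have "(\<Sum>m\<in>{0<..n - 1}. ?b m) = 4 * harm (n - 1)"
    by (simp only: sum.distrib sum_distrib_left[symmetric] harm_eq_sum)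
  then show "(\<Sum>m\<in>{0<..n - 1}. ?b m) \<le> 4 * harm n"
    using harm_mono[of "n - 1" n, where 'a=real] by simp
qed (use delta_pos in auto)

end

section \<open>The limits at roots of unity\<close>

lemma log_negligible_O_inverse:
  assumes "\<forall>\<^sub>F n in sequentially. norm (e n) \<le> C / real n"
  shows "log_negligible e"
proof (rule log_negligible_bound)
  show "log_negligible (\<lambda>n. \<bar>C\<bar> * (1 / real n))" using log_negligible_inverse[where 'a=real] by (rule log_negligible_cmult)
  show "\<forall>\<^sub>F n in sequentially. norm (e n) \<le> norm (\<bar>C\<bar> * (1 / real n))"
    using assms
  proof eventually_elim
    case (elim n)
    have "C / real n \<le> \<bar>C\<bar> / real n" by (intro divide_right_mono) auto
    then show ?case using elim by (simp add: abs_mult)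
  qed
qed

lemma log_negligible_unit_root: "log_negligible (\<lambda>n. norm (1 - unit_root n))"
proof (rule log_negligible_O_inverse)
  show "\<forall>\<^sub>F n in sequentially. norm (norm (1 - unit_root n)) \<le> (2 * pi) / real n"
    using eventually_ge_at_top[of 2]
  proof eventually_elim
    case (elim n)
    interpret cyclotomic n by unfold_locales (rule elim)
    show ?case using delta_le by (simp add: \<delta>_def)
  qed
qed

lemma half_cut_lower: "half_cut (\<lambda>n. (n - 1) div 2)"
  unfolding half_cut_def by auto

lemma half_cut_upper: "half_cut (\<lambda>n. n div 2)"
  unfolding half_cut_def by auto

lemma q_letter_asymptotics:
  assumes "is_index w"
  shows "log_negligible (\<lambda>n. msum (q_letter n) 0 ((n - 1) div 2) w
            - poly (cpoly (stuffle_reg (e_word w))) (msum (q_letter n) 0 ((n - 1) div 2) [1]))"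
    and "log_bounded (\<lambda>n. msum (q_letter n) 0 ((n - 1) div 2) [1])"
    and "log_negligible (\<lambda>n. msum (q_letter_conj n) 0 (n div 2) w
            - poly (cpoly (stuffle_reg (e_word w))) (msum (q_letter_conj n) 0 (n div 2) [1]))"
proof -
  have "\<forall>\<^sub>F n in sequentially. near_harmonic (q_letter n) (norm (1 - unit_root n)) ((n - 1) div 2) (\<lambda>k. 4 ^ k) \<and>
     near_harmonic (q_letter_conj n) (norm (1 - unit_root n)) (n div 2) (\<lambda>k. 4 ^ k)"
    using eventually_ge_at_top[of 2]
  proof eventually_elim
    case (elim n)
    interpret cyclotomic n by unfold_locales (rule elim)
    show ?case using near_harmonic_q_letter[of "(n - 1) div 2"] near_harmonic_q_letter_conj[of "n div 2"]
      by (simp add: \<delta>_def)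
  qed
  then have ev: "\<forall>\<^sub>F n in sequentially. near_harmonic (q_letter n) (norm (1 - unit_root n)) ((n - 1) div 2) (\<lambda>k. 4 ^ k)"
     "\<forall>\<^sub>F n in sequentially. near_harmonic (q_letter_conj n) (norm (1 - unit_root n)) (n div 2) (\<lambda>k. 4 ^ k)"
    by (auto elim: eventually_mono)
  show "log_negligible (\<lambda>n. msum (q_letter n) 0 ((n - 1) div 2) w
            - poly (cpoly (stuffle_reg (e_word w))) (msum (q_letter n) 0 ((n - 1) div 2) [1]))"
    and "log_bounded (\<lambda>n. msum (q_letter n) 0 ((n - 1) div 2) [1])"
    and "log_negligible (\<lambda>n. msum (q_letter_conj n) 0 (n div 2) w
            - poly (cpoly (stuffle_reg (e_word w))) (msum (q_letter_conj n) 0 (n div 2) [1]))"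
    by (rule near_harmonic_asymptotics[OF ev(1) half_cut_lower log_negligible_unit_root assms]
        near_harmonic_asymptotics[OF ev(2) half_cut_upper log_negligible_unit_root assms])+
qed

text \<open>Termwise \<open>u - v = 1 - q\<close>, so the difference of the two sums is about \<open>n/2\<close> times \<open>q - 1\<close>,
  and \<open>q - 1\<close> is about \<open>2\<pi>\<i>/n\<close>.\<close>
lemma harmonic_shift:
  "log_negligible (\<lambda>n. msum (q_letter_conj n) 0 (n div 2) [1]
      - (\<i> * of_real pi + msum (q_letter n) 0 ((n - 1) div 2) [1]))"
proof (rule log_negligible_O_inverse)
  show "\<forall>\<^sub>F n in sequentially. norm (msum (q_letter_conj n) 0 (n div 2) [1]
      - (\<i> * of_real pi + msum (q_letter n) 0 ((n - 1) div 2) [1])) \<le> (4 + 2 * pi + 2 * pi\<^sup>2) / real n"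
    using eventually_ge_at_top[of 2]
  proof eventually_elim
    case (elim n)
    interpret cyclotomic n by unfold_locales (rule elim)
    define M where "M = (n - 1) div 2"
    define \<theta> where "\<theta> = 2 * pi / real n"
    have M: "real n \<le> 2 * real M + 2" "2 * real M \<le> real n" "M < n" using n by (auto simp: M_def)
    have T: "msum (q_letter n) 0 M [1] = (\<Sum>m\<in>{0<..M}. x m)" by (simp add: q_letter_eq)
    \<comment> \<open>For even \<open>n\<close> the midpoint \<open>n/2\<close> belongs to the upper half, which then has one term more.\<close>
    have "norm ((\<Sum>m\<in>{0<..n div 2}. y m) - (\<Sum>m\<in>{0<..M}. y m)) \<le> 4 / real n"
    proof (cases "n div 2 = M")
      case False
      then have 1: "n div 2 = Suc M" "n = 2 * Suc M" using n by (auto simp: M_def)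
      then have "norm (y (Suc M)) \<le> 2 / real (Suc M)"
        unfolding norm_y by (intro norm_x_le) simp_all
      also have "\<dots> = 4 / real n" unfolding 1(2) by (simp add: field_simps)
      finally show ?thesis unfolding 1(1) by (simp add: sum.nat_ivl_Suc' greaterThanAtMost_upt
            atLeastSucAtMost_greaterThanAtMost[symmetric])
    qed simp
    moreover have "(\<Sum>m\<in>{0<..M}. y m) - (\<Sum>m\<in>{0<..M}. x m) = of_nat M * (q - 1)"
    proof -
      have "(\<Sum>m\<in>{0<..M}. x m) - (\<Sum>m\<in>{0<..M}. y m) = (\<Sum>m\<in>{0<..M}. 1 - q)"
        unfolding sum_subtractf[symmetric] by (intro sum.cong refl x_minus_y) (use M in auto)
      then show ?thesis by (simp add: algebra_simps)
    qed
    moreover have "norm (of_nat M * (q - 1) - \<i> * of_real pi) \<le> (2 * pi + 2 * pi\<^sup>2) / real n"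
    proof -
      have q: "q = exp (\<i> * of_real \<theta>)" by (simp add: unit_root_def \<theta>_def mult_ac)
      have "norm (exp (\<i> * of_real \<theta>) - (\<Sum>k\<le>1. (\<i> * of_real \<theta>) ^ k / fact k)) \<le> \<theta>\<^sup>2"
        using Taylor_exp[of "\<i> * of_real \<theta>" 1] by (simp add: norm_mult power2_eq_square)
      then have E: "norm (q - 1 - \<i> * of_real \<theta>) \<le> \<theta>\<^sup>2" by (simp add: q algebra_simps)
      have "of_nat M * (q - 1) - \<i> * of_real pi =
          of_nat M * (q - 1 - \<i> * of_real \<theta>) + \<i> * of_real (real M * \<theta> - pi)"
        by (simp add: algebra_simps)
      also have "norm \<dots> \<le> real M * \<theta>\<^sup>2 + \<bar>real M * \<theta> - pi\<bar>"
        using E by (intro norm_triangle_mono) (auto simp: norm_mult intro!: mult_left_mono simp flip: of_real_mult of_real_diff)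
      also have "real M * \<theta>\<^sup>2 \<le> real n / 2 * \<theta>\<^sup>2" using M by (intro mult_right_mono) auto
      also have "real n / 2 * \<theta>\<^sup>2 = 2 * pi\<^sup>2 / real n" using n by (simp add: \<theta>_def power2_eq_square)
      also have "real M * \<theta> - pi = - (pi * (real n - 2 * real M) / real n)" using n by (simp add: \<theta>_def field_simps)
      also have "\<bar>- (pi * (real n - 2 * real M) / real n)\<bar> \<le> 2 * pi / real n"
      proof -
        have "pi * (real n - 2 * real M) \<le> pi * 2" using M by (intro mult_left_mono) auto
        then have "pi * (real n - 2 * real M) / real n \<le> 2 * pi / real n"
          by (intro divide_right_mono) auto
        moreover have "0 \<le> pi * (real n - 2 * real M) / real n" using M by simp
        ultimately show ?thesis unfolding abs_minus_cancel by (simp only: abs_of_nonneg)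
      qed
      finally show ?thesis by (simp add: add_divide_distrib)
    qed
    moreover have "norm (s - (c + t)) \<le> a + b"
      if "norm (s - s') \<le> a" "s' - t = d" "norm (d - c) \<le> b" for s s' t c d :: complex and a b
      using norm_triangle_mono[OF that(1) that(3)[folded that(2)]] by (simp add: algebra_simps)
    ultimately have "norm ((\<Sum>m\<in>{0<..n div 2}. y m) - (\<i> * of_real pi + (\<Sum>m\<in>{0<..M}. x m)))
        \<le> 4 / real n + (2 * pi + 2 * pi\<^sup>2) / real n" by blast
    then show ?case unfolding M_def[symmetric] T by (simp add: q_letter_conj_eq add_divide_distrib)
  qed
qed

lemma msum_alternating:
  "msum (\<lambda>k m. (-1) ^ k * t k m) M N w = (-1) ^ sum_list w * msum t M N w"
  by (induction w arbitrary: N) (auto simp: power_add sum_distrib_left mult_ac intro!: sum.cong)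

lemma z_sum_eq_msum: "z_sum n ks (unit_root n) = msum (q_letter n) 0 (n - 1) ks"
proof -
  have "{0<..<n} = {0<..n - 1}" by auto
  then show ?thesis unfolding z_sum_def msum_eq_sum_lists z_term_def q_letter_def by simp
qed

lemma z_star_eq_star_msum: "z_star n ks (unit_root n) = star_msum (q_letter n) (n - 1) ks"
proof -
  have "{0<..<n} = {0<..n - 1}" by auto
  then show ?thesis unfolding z_star_def star_msum_eq_sum_lists z_term_def q_letter_def by simp
qed

lemma z_sum_split:
  assumes "2 \<le> n" "is_index ks"
  shows "z_sum n ks (unit_root n) = (\<Sum>a\<le>length ks. (-1) ^ sum_list (take a ks) *
      (msum (q_letter_conj n) 0 (n div 2) (rev (take a ks)) * msum (q_letter n) 0 ((n - 1) div 2) (drop a ks)))"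
proof -
  interpret cyclotomic n by unfold_locales (rule assms(1))
  let ?M = "(n - 1) div 2"
  have "msum (q_letter n) ?M (n - 1) (take a ks) =
      (-1) ^ sum_list (take a ks) * msum (q_letter_conj n) 0 (n div 2) (rev (take a ks))" for a
  proof -
    have "?M < n" "n - 1 - ?M = n div 2" using n by auto
    then have "msum (q_letter n) ?M (n - 1) (take a ks) =
        msum (\<lambda>k m. q_letter n k (n - m)) 0 (n div 2) (rev (take a ks))"
      using msum_reflect[of ?M n "q_letter n" "rev (take a ks)"] by simp
    also have "\<dots> = msum (\<lambda>k m. (-1) ^ k * q_letter_conj n k m) 0 (n div 2) (rev (take a ks))"
    proof (rule msum_cong)
      fix k m assume "k \<in> set (rev (take a ks))" "0 < m" "m \<le> n div 2"
      then have "1 \<le> k" "m < n" using assms(2) n by (auto simp: is_index_def dest: in_set_takeD)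
      then show "q_letter n k (n - m) = (-1) ^ k * q_letter_conj n k m"
        using \<open>0 < m\<close> by (intro q_letter_reflect) auto
    qed
    finally show ?thesis by (simp add: msum_alternating sum_list_rev)
  qed
  moreover have "?M \<le> n - 1" by simp
  ultimately show ?thesis unfolding z_sum_eq_msum msum_split[OF \<open>?M \<le> n - 1\<close>]
    by (simp add: mult.assoc)
qed

text \<open>If the entry number \<open>a\<close> is 1, both the derivative of \<open>u (a + 1)\<close> and that of \<open>v a\<close> remove it;
  they leave \<open>u a * v (a + 1)\<close> with opposite signs, because the entry counts in only one of the
  exponents \<open>s (a + 1)\<close> and \<open>s a\<close>.\<close>
lemma telescoping_pderiv:
  fixes u v :: "nat \<Rightarrow> 'a::idom poly" and s :: "nat \<Rightarrow> nat"
  assumes u: "\<And>a. a < L \<Longrightarrow> pderiv (u (Suc a)) = (if P a then u a else 0)" "pderiv (u 0) = 0"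
    and v: "\<And>a. a < L \<Longrightarrow> pderiv (v a) = (if P a then v (Suc a) else 0)" "pderiv (v L) = 0"
    and s: "\<And>a. a < L \<Longrightarrow> P a \<Longrightarrow> s (Suc a) = Suc (s a)"
  shows "pderiv (\<Sum>a\<le>L. (-1) ^ s a * (u a * v a)) = 0"
proof -
  have sgn: "pderiv ((-1) ^ j * p) = (-1) ^ j * pderiv p" for j and p :: "'a poly"
    by (cases "even j") (auto simp: pderiv_minus)
  have der_sum: "pderiv (sum f A) = (\<Sum>a\<in>A. pderiv (f a))" for f :: "nat \<Rightarrow> 'a poly" and A
    by (induction A rule: infinite_finite_induct) (auto simp: pderiv_add)
  have "pderiv (\<Sum>a\<le>L. (-1) ^ s a * (u a * v a)) =
      (\<Sum>a\<le>L. (-1) ^ s a * (pderiv (u a) * v a)) + (\<Sum>a\<le>L. (-1) ^ s a * (u a * pderiv (v a)))"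
    unfolding der_sum sgn unfolding pderiv_mult sum.distrib[symmetric]
    by (simp add: algebra_simps)
  also have "(\<Sum>a\<le>L. (-1) ^ s a * (pderiv (u a) * v a)) =
      (\<Sum>a<L. (-1) ^ s (Suc a) * (pderiv (u (Suc a)) * v (Suc a)))"
    by (simp add: sum.atMost_shift u(2))
  also have "(\<Sum>a\<le>L. (-1) ^ s a * (u a * pderiv (v a))) = (\<Sum>a<L. (-1) ^ s a * (u a * pderiv (v a)))"
    by (simp add: lessThan_Suc_atMost[symmetric] v(2))
  also have "(\<Sum>a<L. (-1) ^ s (Suc a) * (pderiv (u (Suc a)) * v (Suc a))) =
      (\<Sum>a<L. - ((-1) ^ s a * (u a * pderiv (v a))))"
    by (intro sum.cong refl) (simp add: u v s)
  finally show ?thesis by (simp add: sum_negf)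
qed

lemma is_index_take: "is_index ks \<Longrightarrow> is_index (take a ks)"
  by (auto simp: is_index_def dest: in_set_takeD)

lemma is_index_drop: "is_index ks \<Longrightarrow> is_index (drop a ks)"
  by (auto simp: is_index_def dest: in_set_dropD)

lemma is_index_rev: "is_index (rev ks) \<longleftrightarrow> is_index ks"
  by (simp add: is_index_def)

text \<open>The polynomial \<open>Q\<close> evaluated at \<open>T n\<close> describes \<open>z_sum\<close> up to negligible terms. It is constant
  although \<open>T n\<close> diverges. The point \<open>-\<pi>\<i>/2\<close> is chosen because it makes the arguments of the two
  factors opposite.\<close>
lemma z_sum_tendsto:
  assumes "is_index ks"
  shows "(\<lambda>n. z_sum n ks (unit_root n)) \<longlonglongrightarrow>
    (\<Sum>a\<le>length ks. (-1) ^ sum_list (take a ks) *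
      (poly (cpoly (stuffle_reg (e_word (rev (take a ks))))) (\<i> * of_real (pi / 2)) *
       poly (cpoly (stuffle_reg (e_word (drop a ks)))) (- (\<i> * of_real (pi / 2)))))"
proof -
  define U where "U a = cpoly (stuffle_reg (e_word (rev (take a ks))))" for a
  define u where "u a = pcompose (U a) [:\<i> * of_real pi, 1:]" for a
  define v where "v a = cpoly (stuffle_reg (e_word (drop a ks)))" for a
  define s where "s a = sum_list (take a ks)" for a
  define Q where "Q = (\<Sum>a\<le>length ks. (-1) ^ s a * (u a * v a))"
  define T where "T n = msum (q_letter n) 0 ((n - 1) div 2) [1]" for n
  have "pderiv Q = 0" unfolding Q_def
  proof (rule telescoping_pderiv[where P="\<lambda>a. ks ! a = 1"])
    have comp: "pderiv (u a) = pcompose (pderiv (U a)) [:\<i> * of_real pi, 1:]" for a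
      by (simp add: u_def pderiv_pcompose pderiv_pCons)
    have reg_Nil: "pderiv (stuffle_reg (e_word [])) = 0"
      by (simp add: stuffle_reg_admissible admissible_def pderiv_pCons)
    show "pderiv (u 0) = 0" unfolding comp by (simp add: U_def cpoly_pderiv[symmetric] reg_Nil)
    show "pderiv (v (length ks)) = 0" by (simp add: v_def cpoly_pderiv[symmetric] reg_Nil)
    fix a assume a: "a < length ks"
    have i: "is_index (ks ! a # rev (take a ks))" "is_index (ks ! a # drop (Suc a) ks)"
      using assms a is_index_take[of ks a] is_index_drop[of ks "Suc a"] is_index_rev by (auto simp: is_index_def)
    have t: "rev (take (Suc a) ks) = ks ! a # rev (take a ks)" "drop a ks = ks ! a # drop (Suc a) ks"
      using a by (auto simp: take_Suc_conv_app_nth Cons_nth_drop_Suc)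
    show "pderiv (u (Suc a)) = (if ks ! a = 1 then u a else 0)"
      unfolding comp unfolding U_def t cpoly_pderiv[symmetric] pderiv_stuffle_reg_Cons[OF i(1)]
      by (simp add: u_def U_def)
    show "pderiv (v a) = (if ks ! a = 1 then v (Suc a) else 0)"
      unfolding v_def t(2) cpoly_pderiv[symmetric] pderiv_stuffle_reg_Cons[OF i(2)] by simp
    show "s (Suc a) = Suc (s a)" if "ks ! a = 1"
      using a that by (simp add: s_def take_Suc_conv_app_nth)
  qed
  then obtain h where h: "Q = [:h:]" using pderiv_iszero by blast
  have neg1: "poly ((-1) ^ j) c = (-1) ^ j" for j and c :: complex by (simp add: poly_power)
  have T: "log_bounded T" unfolding T_def by (rule q_letter_asymptotics(2)[of "[]"]) simp
  have T': "log_bounded (\<lambda>n. \<i> * of_real pi + T n)" by (intro log_bounded_add log_bounded_const T)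
  have U: "log_negligible (\<lambda>n. msum (q_letter_conj n) 0 (n div 2) (rev (take a ks)) - poly (u a) (T n))" for a
  proof -
    have "log_negligible (\<lambda>n. msum (q_letter_conj n) 0 (n div 2) (rev (take a ks))
        - poly (U a) (msum (q_letter_conj n) 0 (n div 2) [1]))"
      unfolding U_def by (rule q_letter_asymptotics(3)) (simp add: assms is_index_rev is_index_take)
    from log_negligible_add[OF this log_negligible_poly_cong[OF harmonic_shift[folded T_def] T', of "U a"]]
    show ?thesis by (simp add: u_def poly_pcompose)
  qed
  have V: "log_negligible (\<lambda>n. msum (q_letter n) 0 ((n - 1) div 2) (drop a ks) - poly (v a) (T n))" for a
    unfolding v_def T_def by (rule q_letter_asymptotics(1)) (simp add: assms is_index_drop)
  have "log_negligible (\<lambda>n. \<Sum>a\<le>length ks. (-1) ^ s a * (msum (q_letter_conj n) 0 (n div 2) (rev (take a ks)) *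
      msum (q_letter n) 0 ((n - 1) div 2) (drop a ks) - poly (u a) (T n) * poly (v a) (T n)))"
    by (intro log_negligible_sum log_negligible_cmult log_negligible_mult_cong U V log_bounded_poly T)
  from log_negligible_tendsto[OF this]
  have "(\<lambda>n. (\<Sum>a\<le>length ks. (-1) ^ s a * (msum (q_letter_conj n) 0 (n div 2) (rev (take a ks)) *
      msum (q_letter n) 0 ((n - 1) div 2) (drop a ks) - poly (u a) (T n) * poly (v a) (T n))) + h) \<longlonglongrightarrow> 0 + h"
    by (intro tendsto_add tendsto_const)
  moreover have "\<forall>\<^sub>F n in sequentially. (\<Sum>a\<le>length ks. (-1) ^ s a * (msum (q_letter_conj n) 0 (n div 2) (rev (take a ks)) *
      msum (q_letter n) 0 ((n - 1) div 2) (drop a ks) - poly (u a) (T n) * poly (v a) (T n))) + h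
      = z_sum n ks (unit_root n)"
    using eventually_ge_at_top[of 2]
  proof eventually_elim
    case (elim n)
    have "h = (\<Sum>a\<le>length ks. (-1) ^ s a * (poly (u a) (T n) * poly (v a) (T n)))"
      using arg_cong[OF h, of "\<lambda>p. poly p (T n)"] unfolding Q_def by (simp add: poly_sum neg1)
    then show ?case unfolding z_sum_split[OF elim assms]
      by (simp add: right_diff_distrib sum_subtractf s_def)
  qed
  ultimately have "(\<lambda>n. z_sum n ks (unit_root n)) \<longlonglongrightarrow> h"
    using Lim_transform_eventually by fastforce
  moreover have "h = poly Q (- (\<i> * of_real (pi / 2)))" by (simp add: h)
  moreover have "\<i> * of_real pi - \<i> * of_real (pi / 2) = \<i> * of_real (pi / 2)"
    by (simp add: algebra_simps)
  ultimately show ?thesis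
    by (simp add: Q_def poly_sum neg1 u_def poly_pcompose U_def v_def s_def)
qed

lemma xi_eq_lim: "is_index ks \<Longrightarrow> (\<lambda>n. z_sum n ks (unit_root n)) \<longlonglongrightarrow> xi ks"
  using z_sum_tendsto limI unfolding xi_def by fastforce

section \<open>Congruences modulo \<open>\<zeta>(2)\<close>\<close>

lemma cong_mod_zeta2_refl: "cong_mod_zeta2 x x"
  unfolding cong_mod_zeta2_def using mzv_space_0 by (auto intro!: exI[of _ 0])

lemma cong_mod_zeta2_add:
  assumes "cong_mod_zeta2 x x'" "cong_mod_zeta2 y y'"
  shows "cong_mod_zeta2 (x + y) (x' + y')"
proof -
  obtain a b where ab: "x - x' = mzv [2] * a" "a \<in> mzv_space" "y - y' = mzv [2] * b" "b \<in> mzv_space"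
    using assms unfolding cong_mod_zeta2_def by blast
  then have "x + y - (x' + y') = mzv [2] * (a + b)" by (simp add: algebra_simps)
  then show ?thesis unfolding cong_mod_zeta2_def using ab mzv_space_add by blast
qed

lemma cong_mod_zeta2_sum: "(\<And>i. i \<in> A \<Longrightarrow> cong_mod_zeta2 (f i) (g i)) \<Longrightarrow> cong_mod_zeta2 (sum f A) (sum g A)"
  by (induction A rule: infinite_finite_induct) (auto intro: cong_mod_zeta2_add cong_mod_zeta2_refl)

lemma cong_mod_zeta2_scale:
  assumes "cong_mod_zeta2 x y" shows "cong_mod_zeta2 (of_rat c * x) (of_rat c * y)"
proof -
  obtain a where a: "x - y = mzv [2] * a" "a \<in> mzv_space"
    using assms unfolding cong_mod_zeta2_def by blast
  then have "of_rat c * x - of_rat c * y = mzv [2] * (of_rat c * a)" by (metis mult.left_commute right_diff_distrib)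
  then show ?thesis unfolding cong_mod_zeta2_def using a mzv_space_scale by blast
qed

lemma cong_mod_zeta2_sign: "cong_mod_zeta2 x y \<Longrightarrow> cong_mod_zeta2 ((-1) ^ j * x) ((-1) ^ j * y)"
  using cong_mod_zeta2_scale[of x y "(-1) ^ j"] by (simp add: of_rat_power)

text \<open>Even powers of \<open>\<pi>\<i>/2\<close> are rational multiples of powers of \<open>\<zeta>(2)\<close> and odd ones are imaginary.
  The induction removes two coefficients at a time.\<close>
lemma Re_poly_imaginary:
  assumes "mzv_poly p"
  shows "Re (poly (cpoly p) (\<i> * of_real (pi / 2))) \<in> mzv_space \<and>
         cong_mod_zeta2 (Re (poly (cpoly p) (\<i> * of_real (pi / 2)))) (poly p 0)"
  using assms
proof (induction "degree p" arbitrary: p rule: less_induct)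
  case less
  obtain a b p' where p: "p = pCons a (pCons b p')" by (metis pCons_cases)
  show ?case
  proof (cases "pCons b p' = 0")
    case True
    then show ?thesis using less(2) by (simp add: p mzv_poly_pCons cong_mod_zeta2_refl)
  next
    case False
    let ?r = "Re (poly (cpoly p') (\<i> * of_real (pi / 2)))"
    have "degree p' < degree p" using False by (auto simp: p)
    then have r: "?r \<in> mzv_space" using less by (auto simp: p mzv_poly_pCons)
    define w where "w = of_rat (- (3 / 2)) * ?r"
    have w: "w \<in> mzv_space" unfolding w_def by (rule mzv_space_scale[OF r])
    have w': "w = - (3 / 2) * ?r" by (simp add: w_def of_rat_minus of_rat_divide)
    have eq: "Re (poly (cpoly p) (\<i> * of_real (pi / 2))) = a + mzv [2] * w"
      unfolding w' mzv_2 by (simp add: p power2_eq_square algebra_simps)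
    have "mzv [2] \<in> mzv_space" "a \<in> mzv_space"
      using less(2) by (auto simp: p mzv_poly_pCons admissible_def intro!: mzv_in_mzv_space)
    then show ?thesis unfolding eq using w
      by (auto simp: cong_mod_zeta2_def p intro!: mzv_space_add mzv_space_mult)
  qed
qed

lemma mzv_poly_reflect:
  assumes "mzv_poly p" shows "mzv_poly (pcompose p [:0, -1:])"
  using assms
proof (induction p)
  case (pCons a p)
  have "- 1 = of_rat (- 1) * (1::real)" by simp
  then have "mzv_poly [:0, -1:]"
    using mzv_space_scale[OF one_in_mzv_space, of "- 1"] by (simp add: mzv_poly_pCons mzv_poly_0 mzv_space_0)
  then show ?case using pCons unfolding pcompose_pCons
    by (intro mzv_poly_add mzv_poly_mult) (auto simp: mzv_poly_pCons mzv_poly_0)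
qed (simp add: mzv_poly_0)

lemma poly_cpoly_reflect: "poly (cpoly (pcompose p [:0, -1:])) z = poly (cpoly p) (- z)"
  by (induction p) (auto simp: pcompose_pCons cpoly_add cpoly_mult simp del: mult_pCons_left)

text \<open>The reflection \<open>T \<mapsto> -T\<close> of the second factor turns the product into one polynomial evaluated at
  one point.\<close>
lemma Re_product_imaginary:
  assumes "mzv_poly p" "mzv_poly q"
  shows "cong_mod_zeta2 (Re (poly (cpoly p) (\<i> * of_real (pi / 2)) * poly (cpoly q) (- (\<i> * of_real (pi / 2)))))
           (poly p 0 * poly q 0)"
  using Re_poly_imaginary[of "p * pcompose q [:0, -1:]"] assms
  by (simp add: mzv_poly_mult mzv_poly_reflect cpoly_mult poly_cpoly_reflect poly_pcompose)

lemma xi_cong: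
  assumes "is_index ks" shows "cong_mod_zeta2 (Re (xi ks)) (zeta_S ks)"
proof -
  let ?p = "\<lambda>a. stuffle_reg (e_word (rev (take a ks)))" and ?q = "\<lambda>a. stuffle_reg (e_word (drop a ks))"
  let ?z = "\<lambda>a. poly (cpoly (?p a)) (\<i> * of_real (pi / 2)) * poly (cpoly (?q a)) (- (\<i> * of_real (pi / 2)))"
  have "xi ks = (\<Sum>a\<le>length ks. (-1) ^ sum_list (take a ks) * ?z a)"
    using LIMSEQ_unique[OF xi_eq_lim[OF assms] z_sum_tendsto[OF assms]] .
  then have "Re (xi ks) = (\<Sum>a\<le>length ks. Re ((-1) ^ sum_list (take a ks) * ?z a))" by simp
  also have "\<dots> = (\<Sum>a\<le>length ks. (-1) ^ sum_list (take a ks) * Re (?z a))"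
  proof (rule sum.cong)
    show "Re ((-1) ^ j * z) = (-1) ^ j * Re z" for j z by (cases "even j") auto
  qed simp
  also have "cong_mod_zeta2 \<dots> (\<Sum>a\<le>length ks. (-1) ^ sum_list (take a ks) * (poly (?p a) 0 * poly (?q a) 0))"
    using assms by (intro cong_mod_zeta2_sum cong_mod_zeta2_sign Re_product_imaginary mzv_poly_stuffle_reg)
      (auto simp: is_index_rev is_index_take is_index_drop)
  also have "(\<Sum>a\<le>length ks. (-1) ^ sum_list (take a ks) * (poly (?p a) 0 * poly (?q a) 0)) = zeta_S ks"
    by (simp add: zeta_S_def zeta_S_poly_def poly_sum poly_power mult.assoc)
  finally show ?thesis .
qed

lemma z_star_tendsto:
  assumes "is_index ks"
  shows "(\<lambda>n. z_star n ks (unit_root n)) \<longlonglongrightarrow> fill_sum xi ks"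
proof -
  let ?e = "\<lambda>n. z_star n ks (unit_root n) - fill_sum (\<lambda>v. z_sum n v (unit_root n)) ks"
  have "log_bounded (\<lambda>n. (4 * (1 + 4 * harm n)) ^ length ks :: real)"
    using log_bounded_poly[OF log_bounded_harm, of "[:4, 16:] ^ length ks"]
    by (simp add: poly_power algebra_simps)
  then have "log_negligible (\<lambda>n. norm (1 - unit_root n) * (4 * (1 + 4 * harm n)) ^ length ks)"
    by (rule log_negligible_mult[OF log_negligible_unit_root])
  moreover have "\<forall>\<^sub>F n in sequentially. norm (?e n) \<le>
      norm (norm (1 - unit_root n) * (4 * (1 + 4 * harm n)) ^ length ks)"
    using eventually_ge_at_top[of 2]
  proof eventually_elim
    case (elim n)
    interpret cyclotomic n by unfold_locales (rule elim)
    have "norm (?e n) \<le> \<delta> * (4 * (1 + 4 * harm n)) ^ length ks"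
      unfolding z_star_eq_star_msum z_sum_eq_msum
      by (rule approx_letters.star_msum_approx[OF approx_letters_q_letter assms order_refl])
    then show ?case by (simp add: abs_mult harm_nonneg \<delta>_def)
  qed
  ultimately have "log_negligible ?e" by (rule log_negligible_bound)
  then have "?e \<longlonglongrightarrow> 0" by (rule log_negligible_tendsto)
  moreover have "(\<lambda>n. fill_sum (\<lambda>v. z_sum n v (unit_root n)) ks) \<longlonglongrightarrow> fill_sum xi ks"
    unfolding fill_sum_def by (intro tendsto_sum xi_eq_lim is_index_fill assms)
  ultimately have "(\<lambda>n. ?e n + fill_sum (\<lambda>v. z_sum n v (unit_root n)) ks) \<longlonglongrightarrow> 0 + fill_sum xi ks"
    by (rule tendsto_add)
  then show ?thesis by simp
qed

theorem theorem1p2: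
  fixes ks :: "nat list"
  assumes "is_index ks"
  shows "convergent (\<lambda>n. z_sum n ks (unit_root n))
       \<and> convergent (\<lambda>n. z_star n ks (unit_root n))
       \<and> cong_mod_zeta2 (Re (xi ks)) (zeta_S ks)
       \<and> cong_mod_zeta2 (Re (xi_star ks)) (zeta_S_star ks)"
proof (intro conjI)
  show "convergent (\<lambda>n. z_sum n ks (unit_root n))" "convergent (\<lambda>n. z_star n ks (unit_root n))"
    using xi_eq_lim[OF assms] z_star_tendsto[OF assms] by (auto simp: convergent_def)
  show "cong_mod_zeta2 (Re (xi ks)) (zeta_S ks)" by (rule xi_cong[OF assms])
  have "xi_star ks = fill_sum xi ks" unfolding xi_star_def by (rule limI[OF z_star_tendsto[OF assms]])
  then show "cong_mod_zeta2 (Re (xi_star ks)) (zeta_S_star ks)"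
    unfolding zeta_S_star_def fill_sum_def using assms
    by (auto intro!: cong_mod_zeta2_sum xi_cong is_index_fill)
qed

end
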